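(* Let $G$ be a discrete group, let $(X,G)$ be a tame $G$-flow, let $\mathcal M$ be a minimal left ideal of $E:=E(X,G)$, let $u\in\mathcal M$ be an idempotent, put $K:=u\mathcal M$ and let $j:K\to E$ be the inclusion. Let $\mathfrak h_K$ be the normalized Haar measure on the compact Hausdorff topological group $(K,\tau)$. The formula $$\Lambda_K(F):=\int_K F(j(k))\,d\mathfrak h_K(k)\qquad(F\in C(E,\mathbb C))$$ defines a positive unital complex-linear functional on $C(E,\mathbb C)$. Consequently, there is a unique regular Borel probability measure $\mu_K$ on $E$ such that $$\int_E F\,d\mu_K=\int_K F(j(k))\,d\mathfrak h_K(k)\qquad\text{for every }F\in C(E,\mathbb C).$$
   Context: All compact spaces are Hausdorff. A $G$-flow $(X,G)$ is a compact space $X$ with an action of the discrete group $G$ by homeomorphisms. The enveloping semigroup $E=E(X,G)$ is the closure of $\{g_X:g\in G\}$ in $X^X$ with the product topology, where $g_X(x)=gx$; it is a semigroup under composition. A map $f:X\to Y$ from a compact space to a uniform space is fragmented if for every nonempty $A\subseteq X$ and every entourage $V$ of $Y$ there is a nonempty relatively open $U\subseteq A$ with $(f(x),f(y))\in V$ for all $x,y\in U$. The flow $(X,G)$ is tame if every element of $E$ is a fragmented map $X\to X$ (with $X$ carrying its unique compatible uniformity). For a minimal left ideal $\mathcal M$ of $E$ and an idempotent $u\in\mathcal M$, the set $K=u\mathcal M$ is a group (an Ellis group). For $p\in E$, $A\subseteq E$ let $p\circ A$ be the set of $q\in E$ for which there are nets $(g_i)$ in $G$ and $(a_i)$ in $A$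 with $g_i\to p$ and $g_ia_i\to q$. The $\tau$-topology on $K$ is the topology with closure operator $\operatorname{cl}_\tau(A)=K\cap(u\circ A)$. When $(X,G)$ is tame, $(K,\tau)$ is a compact Hausdorff topological group. Integrals over $K$ are taken with respect to the completion of $\mathfrak h_K$; note that $j$ need not be Borel from $(K,\tau)$ to $E$. Positivity of a functional $\Lambda$ means $\Lambda(F)\geqslant0$ for every $F\in C(E,\mathbb C)$ that is real-valued and nonnegative; unital means $\Lambda(1_E)=1$. *)

theory Defs
  imports "HOL-Probability.Probability" "HOL-Algebra.Group_Action"
begin

subsection \<open>Flows, enveloping semigroups, tameness\<close>

text \<open>
  The compact space \<open>X\<close> is the universe of a type of sort \<open>{uniform_space, t2_space}\<close> with compact
  universe. Every compact Hausdorff space has exactly one compatible uniformity, so the class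
  \<open>uniform_space\<close> is no restriction and its filter \<open>uniformity\<close> is that uniformity. The type
  \<open>'x \<Rightarrow> 'x\<close> carries the product topology.
\<close>

definition flow :: "('g, 'm) monoid_scheme \<Rightarrow> ('g \<Rightarrow> 'x \<Rightarrow> 'x::{uniform_space, t2_space}) \<Rightarrow> bool" where
  "flow G act \<longleftrightarrow>
     compact (UNIV :: 'x set) \<and>
     group G \<and> group_action G UNIV act \<and>
     (\<forall>g\<in>carrier G. homeomorphic_map euclidean euclidean (act g))"

definition enveloping_semigroup ::
    "('g, 'm) monoid_scheme \<Rightarrow> ('g \<Rightarrow> 'x \<Rightarrow> 'x::topological_space) \<Rightarrow> ('x \<Rightarrow> 'x) set" where
  "enveloping_semigroup G act = closure (act ` carrier G)"

definition fragmented_map :: "('a::topological_space \<Rightarrow> 'b::uniform_space) \<Rightarrow> bool" where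
  "fragmented_map f \<longleftrightarrow>
     (\<forall>A V. A \<noteq> {} \<and> eventually (\<lambda>z. z \<in> V) uniformity \<longrightarrow>
        (\<exists>U. openin (top_of_set A) U \<and> U \<noteq> {} \<and> (\<forall>x\<in>U. \<forall>y\<in>U. (f x, f y) \<in> V)))"

definition tame_flow :: "('g, 'm) monoid_scheme \<Rightarrow> ('g \<Rightarrow> 'x \<Rightarrow> 'x::{uniform_space, t2_space}) \<Rightarrow> bool" where
  "tame_flow G act \<longleftrightarrow> flow G act \<and> (\<forall>p\<in>enveloping_semigroup G act. fragmented_map p)"


subsection \<open>Minimal left ideals, Ellis groups and the tau-topology\<close>

definition left_ideal :: "('x \<Rightarrow> 'x) set \<Rightarrow> ('x \<Rightarrow> 'x) set \<Rightarrow> bool" where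
  "left_ideal S I \<longleftrightarrow> I \<noteq> {} \<and> I \<subseteq> S \<and> (\<forall>p\<in>S. \<forall>q\<in>I. p \<circ> q \<in> I)"

definition minimal_left_ideal :: "('x \<Rightarrow> 'x) set \<Rightarrow> ('x \<Rightarrow> 'x) set \<Rightarrow> bool" where
  "minimal_left_ideal S I \<longleftrightarrow> left_ideal S I \<and> (\<forall>J. left_ideal S J \<and> J \<subseteq> I \<longrightarrow> J = I)"

definition ellis_group :: "('x \<Rightarrow> 'x) set \<Rightarrow> ('x \<Rightarrow> 'x) \<Rightarrow> ('x \<Rightarrow> 'x) monoid" where
  "ellis_group M u = \<lparr>carrier = (\<lambda>m. u \<circ> m) ` M, mult = (\<circ>), one = u\<rparr>"

text \<open>
  The pair of nets \<open>(g\<^sub>i)\<close>, \<open>(a\<^sub>i)\<close> is encoded by a proper filter on pairs: a net of pairs yields the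
  filter of sets it is eventually in, and every proper filter arises in this way.
\<close>

definition circ_op ::
    "('g, 'm) monoid_scheme \<Rightarrow> ('g \<Rightarrow> 'x \<Rightarrow> 'x::topological_space) \<Rightarrow>
     ('x \<Rightarrow> 'x) \<Rightarrow> ('x \<Rightarrow> 'x) set \<Rightarrow> ('x \<Rightarrow> 'x) set" where
  "circ_op G act p A =
     {q \<in> enveloping_semigroup G act.
        \<exists>F :: ('g \<times> ('x \<Rightarrow> 'x)) filter. F \<noteq> bot \<and>
          eventually (\<lambda>(g, a). g \<in> carrier G \<and> a \<in> A) F \<and>
          ((\<lambda>(g, a). act g) \<longlongrightarrow> p) F \<and>
          ((\<lambda>(g, a). act g \<circ> a) \<longlongrightarrow> q) F}"

definition tau_closure ::
    "('g, 'm) monoid_scheme \<Rightarrow> ('g \<Rightarrow> 'x \<Rightarrow> 'x::topological_space) \<Rightarrow>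
     ('x \<Rightarrow> 'x) set \<Rightarrow> ('x \<Rightarrow> 'x) \<Rightarrow> ('x \<Rightarrow> 'x) set \<Rightarrow> ('x \<Rightarrow> 'x) set" where
  "tau_closure G act M u A = carrier (ellis_group M u) \<inter> circ_op G act u A"

text \<open>
  The closed sets are the \<open>C \<subseteq> K\<close> with \<open>cl\<^sub>\<tau> C \<subseteq> C\<close>. That this is a topology, and that its closure
  operator is indeed \<open>cl\<^sub>\<tau>\<close>, is shown in \<open>istopology_tau\<close> and \<open>closure_of_tau_topology\<close> below.
\<close>

definition tau_topology ::
    "('g, 'm) monoid_scheme \<Rightarrow> ('g \<Rightarrow> 'x \<Rightarrow> 'x::topological_space) \<Rightarrow>
     ('x \<Rightarrow> 'x) set \<Rightarrow> ('x \<Rightarrow> 'x) \<Rightarrow> ('x \<Rightarrow> 'x) topology" where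
  "tau_topology G act M u =
     topology (\<lambda>U. U \<subseteq> carrier (ellis_group M u) \<and>
       tau_closure G act M u (carrier (ellis_group M u) - U) \<subseteq> carrier (ellis_group M u) - U)"

lemma circ_op_iff:
  fixes G :: "('g, 'm) monoid_scheme" and act :: "'g \<Rightarrow> 'x \<Rightarrow> 'x::topological_space"
  shows "q \<in> circ_op G act p A \<longleftrightarrow> q \<in> enveloping_semigroup G act \<and>
     (\<forall>N W. open N \<and> p \<in> N \<and> open W \<and> q \<in> W \<longrightarrow>
        (\<exists>g\<in>carrier G. \<exists>a\<in>A. act g \<in> N \<and> act g \<circ> a \<in> W))"
    (is "?l \<longleftrightarrow> _ \<and> ?r")
proof
  assume l: ?l
  then obtain F :: "('g \<times> ('x \<Rightarrow> 'x)) filter" where F: "F \<noteq> bot"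
      "eventually (\<lambda>(g, a). g \<in> carrier G \<and> a \<in> A) F"
      "((\<lambda>(g, a). act g) \<longlongrightarrow> p) F" "((\<lambda>(g, a). act g \<circ> a) \<longlongrightarrow> q) F"
    unfolding circ_op_def by blast
  have ?r
  proof (intro allI impI, elim conjE)
    fix N W assume NW: "open N" "p \<in> N" "open W" "q \<in> W"
    have "eventually (\<lambda>x. (case x of (g, a) \<Rightarrow> act g) \<in> N) F"
      using F(3) NW topological_tendstoD by fast
    moreover have "eventually (\<lambda>x. (case x of (g, a) \<Rightarrow> act g \<circ> a) \<in> W) F"
      using F(4) NW topological_tendstoD by fast
    ultimately have "eventually (\<lambda>x. (case x of (g, a) \<Rightarrow> act g) \<in> N \<and>
        (case x of (g, a) \<Rightarrow> act g \<circ> a) \<in> W \<and>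
        (case x of (g, a) \<Rightarrow> g \<in> carrier G \<and> a \<in> A)) F"
      using F(2) by (simp add: eventually_conj_iff)
    then have "\<exists>x. (case x of (g, a) \<Rightarrow> act g) \<in> N \<and>
        (case x of (g, a) \<Rightarrow> act g \<circ> a) \<in> W \<and>
        (case x of (g, a) \<Rightarrow> g \<in> carrier G \<and> a \<in> A)"
      by (rule eventually_happens'[OF F(1)])
    then show "\<exists>g\<in>carrier G. \<exists>a\<in>A. act g \<in> N \<and> act g \<circ> a \<in> W" by auto
  qed
  with l show "q \<in> enveloping_semigroup G act \<and> ?r" by (simp add: circ_op_def)
next
  assume r: "q \<in> enveloping_semigroup G act \<and> ?r"
  define f where "f = (\<lambda>x :: 'g \<times> ('x \<Rightarrow> 'x). case x of (g, a) \<Rightarrow> (act g, act g \<circ> a))"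
  define F where "F = inf (filtercomap f (nhds p \<times>\<^sub>F nhds q)) (principal (carrier G \<times> A))"
  have "filterlim f (nhds p \<times>\<^sub>F nhds q) F"
    unfolding F_def by (rule filterlim_mono[OF filterlim_filtercomap order_refl]) simp
  then have f: "filterlim f (nhds (p, q)) F" by (simp add: nhds_prod)
  have lim1: "((\<lambda>(g, a). act g) \<longlongrightarrow> p) F"
    using tendsto_fst[OF f] by (simp add: f_def case_prod_beta')
  have lim2: "((\<lambda>(g, a). act g \<circ> a) \<longlongrightarrow> q) F"
    using tendsto_snd[OF f] by (simp add: f_def case_prod_beta')
  have ev: "eventually (\<lambda>(g, a). g \<in> carrier G \<and> a \<in> A) F"
    unfolding F_def eventually_inf_principal by (auto intro!: always_eventually)
  have "F \<noteq> bot"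
  proof
    assume "F = bot"
    then have "eventually (\<lambda>x. x \<notin> carrier G \<times> A) (filtercomap f (nhds p \<times>\<^sub>F nhds q))"
      unfolding F_def trivial_limit_def eventually_inf_principal by (auto elim: eventually_mono)
    then obtain P where P: "eventually P (nhds p \<times>\<^sub>F nhds q)" "\<And>x. P (f x) \<Longrightarrow> x \<notin> carrier G \<times> A"
      unfolding eventually_filtercomap by blast
    then obtain Q R where QR: "eventually Q (nhds p)" "eventually R (nhds q)"
        "\<And>x y. Q x \<Longrightarrow> R y \<Longrightarrow> P (x, y)"
      unfolding eventually_prod_filter by blast
    obtain N where N: "open N" "p \<in> N" "\<And>x. x \<in> N \<Longrightarrow> Q x"
      using QR(1) unfolding eventually_nhds by blast
    obtain W where W: "open W" "q \<in> W" "\<And>x. x \<in> W \<Longrightarrow> R x"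
      using QR(2) unfolding eventually_nhds by blast
    obtain g a where "g \<in> carrier G" "a \<in> A" "act g \<in> N" "act g \<circ> a \<in> W"
      using r N W by blast
    then show False using P(2)[of "(g, a)"] QR(3) N(3) W(3) by (simp add: f_def)
  qed
  then show ?l using r lim1 lim2 ev unfolding circ_op_def by blast
qed

lemma circ_op_empty: "circ_op G act p {} = {}"
  unfolding set_eq_iff circ_op_iff by (metis UNIV_I empty_iff open_UNIV)

lemma circ_op_mono: "A \<subseteq> B \<Longrightarrow> circ_op G act p A \<subseteq> circ_op G act p B"
  unfolding subset_iff circ_op_iff by meson

lemma circ_op_Un: "circ_op G act p (A \<union> B) = circ_op G act p A \<union> circ_op G act p B"
proof
  show "circ_op G act p (A \<union> B) \<subseteq> circ_op G act p A \<union> circ_op G act p B"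
  proof (rule subsetI, rule ccontr)
    fix q assume q: "q \<in> circ_op G act p (A \<union> B)"
      and n: "q \<notin> circ_op G act p A \<union> circ_op G act p B"
    then have E: "q \<in> enveloping_semigroup G act" by (simp add: circ_op_iff)
    obtain N W where 1: "open N" "p \<in> N" "open W" "q \<in> W"
        "\<not> (\<exists>g\<in>carrier G. \<exists>a\<in>A. act g \<in> N \<and> act g \<circ> a \<in> W)"
      using n E unfolding Un_iff circ_op_iff by blast
    obtain N' W' where 2: "open N'" "p \<in> N'" "open W'" "q \<in> W'"
        "\<not> (\<exists>g\<in>carrier G. \<exists>a\<in>B. act g \<in> N' \<and> act g \<circ> a \<in> W')"
      using n E unfolding Un_iff circ_op_iff by blast
    have "open (N \<inter> N')" "p \<in> N \<inter> N'" "open (W \<inter> W')" "q \<in> W \<inter> W'" using 1 2 by auto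
    then obtain g a where "g \<in> carrier G" "a \<in> A \<union> B" "act g \<in> N \<inter> N'" "act g \<circ> a \<in> W \<inter> W'"
      using q unfolding circ_op_iff by blast
    then show False using 1(5) 2(5) by blast
  qed
qed (simp add: circ_op_mono)

lemma istopology_tau:
  "istopology (\<lambda>U. U \<subseteq> carrier (ellis_group M u) \<and>
     tau_closure G act M u (carrier (ellis_group M u) - U) \<subseteq> carrier (ellis_group M u) - U)"
  unfolding istopology_def
proof (intro conjI allI impI)
  let ?K = "carrier (ellis_group M u)"
  let ?L = "\<lambda>U. U \<subseteq> ?K \<and> tau_closure G act M u (?K - U) \<subseteq> ?K - U"
  fix S T assume S: "?L S" and T: "?L T"
  show "S \<inter> T \<subseteq> ?K" using S by blast
  have "tau_closure G act M u (?K - (S \<inter> T))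
      = tau_closure G act M u (?K - S) \<union> tau_closure G act M u (?K - T)"
    by (simp add: tau_closure_def Diff_Int circ_op_Un Int_Un_distrib)
  then show "tau_closure G act M u (?K - (S \<inter> T)) \<subseteq> ?K - (S \<inter> T)" using S T by blast
next
  let ?K = "carrier (ellis_group M u)"
  let ?L = "\<lambda>U. U \<subseteq> ?K \<and> tau_closure G act M u (?K - U) \<subseteq> ?K - U"
  fix \<K> assume L: "\<forall>S\<in>\<K>. ?L S"
  show "\<Union>\<K> \<subseteq> ?K" using L by blast
  have "tau_closure G act M u (?K - \<Union>\<K>) \<subseteq> tau_closure G act M u (?K - S)" if "S \<in> \<K>" for S
    unfolding tau_closure_def using that by (intro Int_mono circ_op_mono) auto
  moreover have "tau_closure G act M u (?K - \<Union>\<K>) \<subseteq> ?K" by (simp add: tau_closure_def)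
  ultimately show "tau_closure G act M u (?K - \<Union>\<K>) \<subseteq> ?K - \<Union>\<K>" using L by blast
qed

lemma openin_tau_topology:
  "openin (tau_topology G act M u) U \<longleftrightarrow> U \<subseteq> carrier (ellis_group M u) \<and>
     tau_closure G act M u (carrier (ellis_group M u) - U) \<subseteq> carrier (ellis_group M u) - U"
  unfolding tau_topology_def by (simp add: istopology_tau)

lemma topspace_tau_topology: "topspace (tau_topology G act M u) = carrier (ellis_group M u)"
proof -
  have "openin (tau_topology G act M u) (carrier (ellis_group M u))"
    by (simp add: openin_tau_topology tau_closure_def circ_op_empty)
  then show ?thesis
    by (metis openin_subset openin_tau_topology openin_topspace subset_antisym)
qed

lemma continuous_comp_left:
  fixes f :: "'x::topological_space \<Rightarrow> 'x"
  assumes "continuous_on UNIV f"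
  shows "continuous_on UNIV (\<lambda>p :: 'x \<Rightarrow> 'x. f \<circ> p)"
proof (rule continuous_on_coordinatewise_then_product)
  fix i :: 'x
  have "continuous_on UNIV (\<lambda>p :: 'x \<Rightarrow> 'x. p i)" by (rule continuous_on_product_coordinates)
  from continuous_on_compose2[OF assms this] show "continuous_on UNIV (\<lambda>p :: 'x \<Rightarrow> 'x. (f \<circ> p) i)"
    by simp
qed

lemma continuous_comp_right: "continuous_on UNIV (\<lambda>p :: 'x::topological_space \<Rightarrow> 'x. p \<circ> a)"
  by (rule continuous_on_coordinatewise_then_product) (simp add: continuous_on_product_coordinates)

lemma closure_of_tau_topology:
  assumes "flow G act" "u \<in> enveloping_semigroup G act" "u \<circ> u = u"
    and sub: "M \<subseteq> enveloping_semigroup G act"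
      "\<And>m. m \<in> M \<Longrightarrow> u \<circ> m \<in> M"
    and A: "A \<subseteq> carrier (ellis_group M u)"
  shows "tau_topology G act M u closure_of A = tau_closure G act M u A"
proof -
  let ?T = "tau_topology G act M u" and ?K = "carrier (ellis_group M u)"
  let ?c = "tau_closure G act M u"
  have cont: "continuous_on UNIV (act g)" if "g \<in> carrier G" for g
    using assms(1) that homeomorphic_imp_continuous_map by (fastforce simp: flow_def)
  have uK: "u \<circ> k = k" if k: "k \<in> ?K" for k
  proof -
    obtain m where "k = u \<circ> m" using k by (auto simp: ellis_group_def)
    then show ?thesis using assms(3) by (simp add: comp_assoc[symmetric])
  qed
  have KE: "?K \<subseteq> enveloping_semigroup G act" using sub by (auto simp: ellis_group_def)
  have ext: "B \<subseteq> ?c B" if B: "B \<subseteq> ?K" for B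
  proof
    fix b assume b: "b \<in> B"
    have "b \<in> circ_op G act u B"
      unfolding circ_op_iff
    proof (intro conjI allI impI)
      show "b \<in> enveloping_semigroup G act" using b B KE by blast
      fix N W assume NW: "open N \<and> u \<in> N \<and> open W \<and> b \<in> W"
      let ?N = "N \<inter> (\<lambda>p. p \<circ> b) -` W"
      have "open ?N" using NW continuous_comp_right open_vimage by blast
      moreover have "u \<in> ?N" using NW uK b B by auto
      ultimately have "\<exists>g\<in>carrier G. act g \<in> ?N"
        using assms(2) unfolding enveloping_semigroup_def closure_iff_nhds_not_empty by blast
      then show "\<exists>g\<in>carrier G. \<exists>a\<in>B. act g \<in> N \<and> act g \<circ> a \<in> W" using b by auto
    qed
    then show "b \<in> ?c B" using b B by (auto simp: tau_closure_def)
  qed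
  have idem: "?c (?c B) \<subseteq> ?c B" for B
  proof
    fix q assume q: "q \<in> ?c (?c B)"
    then have qc: "q \<in> circ_op G act u (?c B)" and qK: "q \<in> ?K"
      by (auto simp: tau_closure_def)
    have "q \<in> circ_op G act u B"
      unfolding circ_op_iff
    proof (intro conjI allI impI)
      show "q \<in> enveloping_semigroup G act" using qK KE by blast
      fix N W assume NW: "open N \<and> u \<in> N \<and> open W \<and> q \<in> W"
      have "open ((\<lambda>p. p \<circ> u) -` N)" "u \<in> (\<lambda>p. p \<circ> u) -` N"
        using NW continuous_comp_right open_vimage assms(3) by auto
      then obtain g b where g: "g \<in> carrier G" "b \<in> ?c B" "act g \<circ> u \<in> N" "act g \<circ> b \<in> W"
        using qc NW unfolding circ_op_iff by blast
      have "open ((\<lambda>p. act g \<circ> p) -` N)" "open ((\<lambda>p. act g \<circ> p) -` W)"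
        using NW continuous_comp_left[OF cont[OF g(1)]] open_vimage by blast+
      moreover have "b \<in> circ_op G act u B" using g by (simp add: tau_closure_def)
      ultimately obtain h a where h: "h \<in> carrier G" "a \<in> B" "act g \<circ> act h \<in> N"
          "act g \<circ> (act h \<circ> a) \<in> W"
        using g unfolding circ_op_iff by (metis vimage_eq)
      interpret group_action G UNIV act using assms(1) by (simp add: flow_def)
      have "act (g \<otimes>\<^bsub>G\<^esub> h) = act g \<circ> act h"
        using composition_rule[OF _ g(1) h(1)] by (simp add: fun_eq_iff)
      moreover have "g \<otimes>\<^bsub>G\<^esub> h \<in> carrier G"
        using g(1) h(1) assms(1) by (simp add: flow_def group.is_monoid monoid.m_closed)
      ultimately show "\<exists>g\<in>carrier G. \<exists>a\<in>B. act g \<in> N \<and> act g \<circ> a \<in> W"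
        using h by (metis comp_assoc)
    qed
    then show "q \<in> ?c B" using qK by (simp add: tau_closure_def)
  qed
  have cl: "closedin ?T C \<longleftrightarrow> C \<subseteq> ?K \<and> ?c C \<subseteq> C" for C
    unfolding closedin_def openin_tau_topology topspace_tau_topology
    by (auto simp: double_diff tau_closure_def)
  show ?thesis
  proof (rule closure_of_unique)
    show "A \<subseteq> ?c A" using ext A by blast
    show "closedin ?T (?c A)" using idem by (auto simp: cl tau_closure_def)
    fix C assume "A \<subseteq> C" "closedin ?T C"
    then show "?c A \<subseteq> C" unfolding cl tau_closure_def using circ_op_mono by blast
  qed
qed


subsection \<open>Regular Borel probability measures and Haar measure\<close>

definition regular_borel_probability :: "'a topology \<Rightarrow> 'a measure \<Rightarrow> bool" where
  "regular_borel_probability T \<mu> \<longleftrightarrow>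
     space \<mu> = topspace T \<and>
     sets \<mu> = sigma_sets (topspace T) {U. openin T U} \<and>
     prob_space \<mu> \<and>
     (\<forall>A\<in>sets \<mu>.
        emeasure \<mu> A = (INF U\<in>{U. openin T U \<and> A \<subseteq> U}. emeasure \<mu> U) \<and>
        emeasure \<mu> A = (SUP C\<in>{C. compactin T C \<and> C \<subseteq> A}. emeasure \<mu> C))"

definition compact_Hausdorff_topological_group :: "('a, 'b) monoid_scheme \<Rightarrow> 'a topology \<Rightarrow> bool" where
  "compact_Hausdorff_topological_group H T \<longleftrightarrow>
     group H \<and> topspace T = carrier H \<and>
     continuous_map (prod_topology T T) T (\<lambda>(x, y). x \<otimes>\<^bsub>H\<^esub> y) \<and>
     continuous_map T T (\<lambda>x. inv\<^bsub>H\<^esub> x) \<and>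
     compact_space T \<and> Hausdorff_space T"

text \<open>
  Haar measure is a notion for a compact Hausdorff topological group, so being one is part of the
  predicate; for the Ellis group of a tame flow with the tau-topology it always holds.
\<close>

definition normalized_Haar_measure :: "('a, 'b) monoid_scheme \<Rightarrow> 'a topology \<Rightarrow> 'a measure \<Rightarrow> bool" where
  "normalized_Haar_measure H T \<nu> \<longleftrightarrow>
     compact_Hausdorff_topological_group H T \<and>
     regular_borel_probability T \<nu> \<and>
     (\<forall>g\<in>carrier H. \<forall>A\<in>sets \<nu>. emeasure \<nu> ((\<lambda>x. g \<otimes>\<^bsub>H\<^esub> x) ` A) = emeasure \<nu> A)"


subsection \<open>Positive unital functionals on spaces of continuous functions\<close>

text \<open>
  An element of \<open>C(E, \<complex>)\<close> is represented by any total function that is continuous on \<open>E\<close>; the first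
  clause says that \<open>\<Lambda>\<close> depends only on the restriction to \<open>E\<close>.
\<close>

definition positive_unital_functional ::
    "'a::topological_space set \<Rightarrow> (('a \<Rightarrow> complex) \<Rightarrow> complex) \<Rightarrow> bool" where
  "positive_unital_functional E \<Lambda> \<longleftrightarrow>
     (\<forall>F F'. continuous_on E F \<and> continuous_on E F' \<and> (\<forall>p\<in>E. F p = F' p) \<longrightarrow> \<Lambda> F = \<Lambda> F') \<and>
     (\<forall>F F'. continuous_on E F \<and> continuous_on E F' \<longrightarrow> \<Lambda> (\<lambda>p. F p + F' p) = \<Lambda> F + \<Lambda> F') \<and>
     (\<forall>c F. continuous_on E F \<longrightarrow> \<Lambda> (\<lambda>p. c * F p) = c * \<Lambda> F) \<and>
     (\<forall>F. continuous_on E F \<and> (\<forall>p\<in>E. F p \<in> \<real> \<and> 0 \<le> Re (F p)) \<longrightarrow> \<Lambda> F \<in> \<real> \<and> 0 \<le> Re (\<Lambda> F)) \<and>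
     \<Lambda> (\<lambda>_. 1) = 1"

end

theory Submission
  imports Defs
begin

text \<open>
  Everything rests on the measurability of \<open>F \<circ> j\<close> for the completed Haar measure, for each
  continuous \<open>F\<close> on \<open>E\<close>. The inclusion \<open>j\<close> itself is hard to handle, because the \<open>\<tau>\<close>-topology
  need not be finer than the pointwise one. A map in the opposite direction is continuous: on the
  pointwise closure \<open>P\<close> of \<open>K\<close>, the map \<open>\<pi> : p \<mapsto> u \<circ> p\<close> is continuous into \<open>(K, \<tau>)\<close>, and it is
  the identity on \<open>K\<close>
  (\<open>continuous_map_u_comp\<close>). So \<open>(K, \<tau>)\<close> is a quotient of the compact space \<open>P\<close>.

  For \<open>x \<in> X\<close> and \<open>\<phi> \<in> C(X)\<close>, the function \<open>f k = \<phi> (k x)\<close> on \<open>K\<close> satisfies \<open>f (\<pi> p) = \<phi> (u (p x))\<close>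
  on \<open>P\<close>. This is where tameness enters: \<open>p \<mapsto> p x\<close> is continuous and \<open>u\<close> is fragmented. Given a set
  \<open>A \<subseteq> K\<close> of positive measure, take a compact \<open>C \<subseteq> A\<close> of positive measure and a closed \<open>Z \<subseteq> P\<close> that is
  minimal with \<open>\<pi> Z \<subseteq> C\<close> and \<open>\<pi> Z\<close> of measure at least that of \<open>C\<close>. Fragmentedness of \<open>u\<close> on \<open>{p x | p \<in> Z}\<close>
  gives a nonempty relatively open \<open>U \<subseteq> Z\<close> on which \<open>f \<circ> \<pi>\<close> oscillates by less than a given bound. By
  minimality \<open>\<pi> Z - \<pi> (Z - U)\<close> has positive measure, and \<open>f\<close> has the same small oscillation on it
  (\<open>fragmented_quotient_small_oscillation\<close>). A function that has small oscillation somewhere inside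
  every set of positive measure is measurable for the completion
  (\<open>borel_measurable_completion_if_small_oscillation\<close>). The Stone-Weierstrass theorem then passes
  from the functions \<open>k \<mapsto> \<phi> (k x)\<close> to all of \<open>C(E)\<close>. As \<open>E\<close> is compact, integrability is clear and
  \<open>\<Lambda>\<^sub>K\<close> is a positive unital functional.

  The representing measure can be built from the measure on \<open>K\<close>, without reference to linear
  functionals. The preimage of a cozero set \<open>{F > 0}\<close> of \<open>E\<close> under \<open>j\<close> is measurable, so cozero sets have a mass.
  The mass of an open set is the supremum over the cozero sets inside it, the mass of an arbitrary
  set the infimum over the open sets around it. Caratheodory's construction turns this
  outer measure into a regular Borel measure (\<open>regular_borel_probability_regular_image\<close>). It has the
  right mass on \<open>{F > c}\<close> for all \<open>c\<close>, hence \<open>F\<close> has the same distribution under both measures and the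
  integrals agree. Uniqueness holds because the integrals of continuous functions determine the mass of
  cozero sets, these determine the mass of open sets by inner regularity and Urysohn's lemma, and
  outer regularity does the rest (\<open>regular_borel_probability_eqI\<close>).
\<close>


section \<open>Products and compact uniform spaces\<close>

lemma open_coordinate_vimage:
  assumes "open U"
  shows "open {h :: 'a \<Rightarrow> 'b::topological_space. h x \<in> U}"
proof -
  have "continuous_on UNIV (\<lambda>h :: 'a \<Rightarrow> 'b. h x)" by simp
  from open_vimage[OF assms this] show ?thesis by (simp add: vimage_def)
qed

text \<open>
  The Stone-Weierstrass theorem for functions on the enveloping semigroup needs the Hausdorff
  property of the type \<open>'x \<Rightarrow> 'x\<close>. The weaker separation axioms come first because the type system
  requires the arities of the superclasses to be at least as general.
\<close>

instance "fun" :: (type, t0_space) t0_space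
proof
  fix f g :: "'a \<Rightarrow> 'b"
  assume "f \<noteq> g"
  then obtain x where "f x \<noteq> g x" by blast
  from t0_space_class.t0_space[OF this] obtain U where "open U" "(f x \<in> U) \<noteq> (g x \<in> U)" by blast
  then show "\<exists>U. open U \<and> (f \<in> U) \<noteq> (g \<in> U)"
    by (intro exI[of _ "{h. h x \<in> U}"]) (simp add: open_coordinate_vimage)
qed

instance "fun" :: (type, t1_space) t1_space
proof
  fix f g :: "'a \<Rightarrow> 'b"
  assume "f \<noteq> g"
  then obtain x where "f x \<noteq> g x" by blast
  from t1_space[OF this] obtain U where "open U" "f x \<in> U" "g x \<notin> U" by blast
  then show "\<exists>U. open U \<and> f \<in> U \<and> g \<notin> U"
    by (intro exI[of _ "{h. h x \<in> U}"]) (simp add: open_coordinate_vimage)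
qed

instance "fun" :: (type, t2_space) t2_space
proof
  fix f g :: "'a \<Rightarrow> 'b"
  assume "f \<noteq> g"
  then obtain x where "f x \<noteq> g x" by blast
  from hausdorff[OF this] obtain U V
    where "open U" "open V" "f x \<in> U" "g x \<in> V" "U \<inter> V = {}" by blast
  then show "\<exists>U V. open U \<and> open V \<and> f \<in> U \<and> g \<in> V \<and> U \<inter> V = {}"
    by (intro exI[of _ "{h. h x \<in> U}"] exI[of _ "{h. h x \<in> V}"]) (auto simp: open_coordinate_vimage)
qed

lemma Hausdorff_space_euclidean_t2: "Hausdorff_space (euclidean :: 'a::t2_space topology)"
  unfolding Hausdorff_space_def using hausdorff by (fastforce simp: disjnt_def)

lemma compact_UNIV_fun:
  assumes "compact (UNIV :: 'b::topological_space set)"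
  shows "compact (UNIV :: ('a \<Rightarrow> 'b) set)"
proof -
  have "compact_space (product_topology (\<lambda>i::'a. euclidean :: 'b topology) UNIV)"
    unfolding compact_space_product_topology using assms by (simp add: compact_space_def)
  then show ?thesis by (simp add: euclidean_product_topology compact_space_def)
qed

text \<open>
  The Heine-Cantor theorem for real functions on compact uniform spaces. It turns a bound on the
  oscillation of \<open>\<phi>\<close> into an entourage, the form in which fragmentedness can be applied.
\<close>

lemma uniformly_continuous_on_compact_space:
  fixes \<phi> :: "'a::uniform_space \<Rightarrow> real"
  assumes "compact (UNIV :: 'a set)" "continuous_on UNIV \<phi>" "0 < e"
  shows "eventually (\<lambda>z. \<bar>\<phi> (fst z) - \<phi> (snd z)\<bar> < e) uniformity"
proof -
  have "\<exists>D N. eventually D uniformity \<and> open N \<and> x \<in> N \<and>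
      (\<forall>y z. y \<in> N \<longrightarrow> D (y, z) \<longrightarrow> \<bar>\<phi> z - \<phi> x\<bar> < e / 2)" for x
  proof -
    have "eventually (\<lambda>y. \<bar>\<phi> y - \<phi> x\<bar> < e / 2) (nhds x)"
    proof -
      have "open (\<phi> -` ball (\<phi> x) (e / 2))" by (intro open_vimage assms(2)) auto
      then show ?thesis
        using assms(3) unfolding eventually_nhds
        by (intro exI[of _ "\<phi> -` ball (\<phi> x) (e / 2)"]) (auto simp: dist_real_def abs_minus_commute)
    qed
    then have "eventually (\<lambda>(x', y). x' = x \<longrightarrow> \<bar>\<phi> y - \<phi> x\<bar> < e / 2) uniformity"
      by (simp add: eventually_nhds_uniformity)
    then obtain D where D: "eventually D uniformity"
      "\<And>a b c. D (a, b) \<Longrightarrow> D (b, c) \<Longrightarrow> (case (a, c) of (x', y) \<Rightarrow> x' = x \<longrightarrow> \<bar>\<phi> y - \<phi> x\<bar> < e / 2)"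
      by (rule uniformity_transE) blast
    have "eventually (\<lambda>y. D (x, y)) (nhds x)"
      unfolding eventually_nhds_uniformity using D(1) by eventually_elim auto
    then obtain N where "open N" "x \<in> N" "\<forall>y\<in>N. D (x, y)"
      unfolding eventually_nhds by blast
    moreover have "\<bar>\<phi> z - \<phi> x\<bar> < e / 2" if "D (x, y)" "D (y, z)" for y z
      using D(2)[OF that] by simp
    ultimately show ?thesis using D(1) by blast
  qed
  then have "\<forall>x. \<exists>D N. eventually D uniformity \<and> open N \<and> x \<in> N \<and>
      (\<forall>y z. y \<in> N \<longrightarrow> D (y, z) \<longrightarrow> \<bar>\<phi> z - \<phi> x\<bar> < e / 2)" by blast
  then obtain D N where "\<forall>x. eventually (D x) uniformity \<and> open (N x) \<and> x \<in> N x \<and>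
      (\<forall>y z. y \<in> N x \<longrightarrow> D x (y, z) \<longrightarrow> \<bar>\<phi> z - \<phi> x\<bar> < e / 2)"
    unfolding choice_iff by (elim exE)
  then have DO: "eventually (D x) uniformity" "open (N x)" "x \<in> N x"
      "y \<in> N x \<Longrightarrow> D x (y, z) \<Longrightarrow> \<bar>\<phi> z - \<phi> x\<bar> < e / 2" for x y z
    by blast+
  have cover: "UNIV \<subseteq> (\<Union>x\<in>UNIV. N x)" using DO(3) by blast
  obtain S where S: "finite S" "UNIV \<subseteq> (\<Union>x\<in>S. N x)"
    by (rule compactE_image[OF assms(1), of UNIV N, OF DO(2) cover])
  have "eventually (\<lambda>z. \<forall>x\<in>S. D x z) uniformity"
    using S(1) DO(1) by (simp add: eventually_ball_finite_distrib)
  then show ?thesis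
  proof eventually_elim
    case (elim z)
    obtain y w where z: "z = (y, w)" by (cases z)
    obtain x where x: "x \<in> S" "y \<in> N x" using S(2) by blast
    have 1: "\<bar>\<phi> w - \<phi> x\<bar> < e / 2" using DO(4) x elim z by blast
    have "D x (y, y)" using DO(1) uniformity_refl by blast
    then have 2: "\<bar>\<phi> y - \<phi> x\<bar> < e / 2" using DO(4) x by blast
    show ?case using 1 2 z by (simp add: abs_if split: if_splits)
  qed
qed

section \<open>Measurability from small oscillation\<close>

text \<open>
  If \<open>f\<close> were not measurable, there would be \<open>a < b\<close> and a set \<open>A\<close> of positive measure in which both
  \<open>{f \<le> a}\<close> and \<open>{f \<ge> b}\<close> have full outer measure. A subset \<open>D\<close> of positive measure with oscillation
  below \<open>b - a\<close> misses one of the two, which therefore has outer measure at most that of \<open>A - D\<close>.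
\<close>

lemma borel_measurable_completion_if_small_oscillation:
  fixes f :: "'a \<Rightarrow> real"
  assumes "finite_measure M"
    and osc: "\<And>A e. A \<in> sets M \<Longrightarrow> 0 < emeasure M A \<Longrightarrow> 0 < e \<Longrightarrow>
      \<exists>D\<in>sets M. D \<subseteq> A \<and> 0 < emeasure M D \<and> (\<forall>x\<in>D. \<forall>y\<in>D. \<bar>f x - f y\<bar> < e)"
  shows "f \<in> borel_measurable (completion M)"
proof (rule cld_measure.borel_measurable_cld)
  interpret M: finite_measure M by fact
  interpret c: complete_measure "completion M" by (rule completion.complete_measure_axioms)
  interpret c: finite_measure "completion M"
    by (rule finite_measureI) simp
  show "cld_measure (completion M)"
  proof unfold_locales
    fix A assume "A \<subseteq> space (completion M)"
      and loc: "\<And>B. B \<in> sets (completion M) \<Longrightarrow> emeasure (completion M) B < \<infinity> \<Longrightarrow>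
        A \<inter> B \<in> sets (completion M)"
    then show "A \<in> sets (completion M)"
      using loc[of "space (completion M)"] by (simp add: Int_absorb2 M.emeasure_finite less_top[symmetric])
  next
    fix A assume "A \<in> sets (completion M)" "emeasure (completion M) A = \<infinity>"
    then show "\<exists>B\<in>sets (completion M). B \<subseteq> A \<and> emeasure (completion M) B < \<infinity>"
      using c.emeasure_finite by simp
  qed
  fix A and a b :: real
  let ?O = "outer_measure_of (completion M)"
  assume A: "A \<in> sets (completion M)" "0 < emeasure (completion M) A" and ab: "a < b"
  have "main_part M A \<in> sets M" "0 < emeasure M (main_part M A)" using A by auto
  moreover have "main_part M A \<subseteq> A" using main_part_null_part_Un[OF A(1)] by blast
  ultimately obtain D where D: "D \<in> sets M" "D \<subseteq> A" "0 < emeasure M D"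
      "\<And>x y. x \<in> D \<Longrightarrow> y \<in> D \<Longrightarrow> \<bar>f x - f y\<bar> < b - a"
    using osc[of "main_part M A" "b - a"] ab by auto
  have Dc: "D \<in> sets (completion M)" using D by simp
  have lt: "emeasure (completion M) (A - D) < emeasure (completion M) A"
  proof -
    have "emeasure (completion M) A = emeasure (completion M) (A - D) + emeasure (completion M) D"
      using plus_emeasure[of "A - D" "completion M" D] A(1) Dc D(2) by (simp add: Un_absorb2 Diff_disjoint Int_commute)
    moreover have "emeasure (completion M) (A - D) \<noteq> \<infinity>" using c.emeasure_finite by simp
    ultimately show ?thesis using D by (simp add: less_top)
  qed
  have small: "?O S < emeasure (completion M) A" if "S \<subseteq> A - D" for S
  proof -
    have "?O S \<le> ?O (A - D)" using that by (rule outer_measure_of_mono)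
    also have "?O (A - D) = emeasure (completion M) (A - D)"
      using A(1) Dc by (intro outer_measure_of_eq) auto
    finally show ?thesis using lt by (rule le_less_trans)
  qed
  show "min (?O {x\<in>A. f x \<le> a}) (?O {x\<in>A. b \<le> f x}) < emeasure (completion M) A"
  proof (cases "\<exists>x\<in>D. f x \<le> a")
    case True
    then obtain x where x: "x \<in> D" "f x \<le> a" by blast
    have "f y < b" if "y \<in> D" for y using D(4)[OF x(1) that] x(2) by linarith
    then have "{x\<in>A. b \<le> f x} \<subseteq> A - D" by force
    from small[OF this] show ?thesis by (rule min.strict_coboundedI2)
  next
    case False
    then have "{x\<in>A. f x \<le> a} \<subseteq> A - D" by blast
    from small[OF this] show ?thesis by (rule min.strict_coboundedI1)
  qed
qed

section \<open>Cozero sets in normal spaces\<close>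

text \<open>
  Cozero sets form a base of the open sets in a normal Hausdorff space, and their preimages under a map
  are measurable as soon as the map pulls continuous real functions back to measurable ones.
\<close>

definition cozero_in :: "'a topology \<Rightarrow> 'a set \<Rightarrow> bool" where
  "cozero_in T V \<longleftrightarrow> (\<exists>F. continuous_map T euclideanreal F \<and> V = {x\<in>topspace T. 0 < F x})"

lemma cozero_in_superlevel:
  assumes "continuous_map T euclideanreal F"
  shows "cozero_in T {x\<in>topspace T. c < F x}"
  unfolding cozero_in_def
  by (rule exI[of _ "\<lambda>x. F x - c"]) (use assms in \<open>auto intro!: continuous_intros\<close>)

lemma openin_superlevel:
  assumes "continuous_map T euclideanreal F"
  shows "openin T {x\<in>topspace T. c < F x}"
  using openin_continuous_map_preimage[OF assms, of "{c<..}"] by simp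

lemma closedin_superlevel:
  assumes "continuous_map T euclideanreal F"
  shows "closedin T {x\<in>topspace T. c \<le> F x}"
  using closedin_continuous_map_preimage[OF assms, of "{c..}"] by simp

lemma cozero_in_openin: "cozero_in T V \<Longrightarrow> openin T V"
  unfolding cozero_in_def by (auto intro: openin_superlevel)

lemma cozero_in_empty: "cozero_in T {}"
  unfolding cozero_in_def by (rule exI[of _ "\<lambda>_. 0"]) simp

lemma cozero_in_topspace: "cozero_in T (topspace T)"
  unfolding cozero_in_def by (rule exI[of _ "\<lambda>_. 1"]) simp

lemma cozero_in_Un:
  assumes "cozero_in T V" "cozero_in T W"
  shows "cozero_in T (V \<union> W)"
proof -
  obtain F H where F: "continuous_map T euclideanreal F" "V = {x\<in>topspace T. 0 < F x}"
    and H: "continuous_map T euclideanreal H" "W = {x\<in>topspace T. 0 < H x}"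
    using assms unfolding cozero_in_def by blast
  have "continuous_map T euclideanreal (\<lambda>x. max (F x) (H x))"
    using F H by (intro continuous_map_real_max)
  moreover have "V \<union> W = {x\<in>topspace T. 0 < max (F x) (H x)}" using F H by auto
  ultimately show ?thesis unfolding cozero_in_def by blast
qed

lemma cozero_between:
  assumes "normal_space T" "closedin T C" "openin T U" "C \<subseteq> U"
  obtains V where "cozero_in T V" "C \<subseteq> V" "V \<subseteq> U"
proof -
  have "closedin T (topspace T - U)" "disjnt (topspace T - U) C"
    using assms by (auto simp: disjnt_def)
  then obtain F where F: "continuous_map T euclideanreal F" "F ` (topspace T - U) \<subseteq> {0}" "F ` C \<subseteq> {1::real}"
    using Urysohn_lemma_alt[OF assms(1), of "topspace T - U" C] assms(2) by metis
  have CT: "C \<subseteq> topspace T" using assms(2) closedin_subset by blast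
  show thesis
  proof
    show "cozero_in T {x\<in>topspace T. 0 < F x}" by (rule cozero_in_superlevel[OF F(1)])
    show "C \<subseteq> {x\<in>topspace T. 0 < F x}" using F(3) CT by fastforce
    show "{x\<in>topspace T. 0 < F x} \<subseteq> U" using F(2) by fastforce
  qed
qed

text \<open>
  This replaces a partition of unity: it transfers a finite open cover of a closed set to cozero sets,
  so that finite subadditivity of the given measure applies.
\<close>

lemma cozero_cover_shrinking:
  fixes k :: nat
  assumes "normal_space T"
  shows "closedin T C \<Longrightarrow> (\<And>n. openin T (U n)) \<Longrightarrow> C \<subseteq> (\<Union>n<k. U n) \<Longrightarrow>
    \<exists>V. (\<forall>n. cozero_in T (V n) \<and> V n \<subseteq> U n) \<and> C \<subseteq> (\<Union>n<k. V n)"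
proof (induction k arbitrary: C)
  case 0
  then show ?case by (intro exI[of _ "\<lambda>_. {}"]) (auto simp: cozero_in_empty)
next
  case (Suc k)
  have "closedin T (C - U k)" using Suc.prems by blast
  moreover have "C - U k \<subseteq> (\<Union>n<k. U n)" using Suc.prems(3) by (auto simp: lessThan_Suc)
  ultimately obtain V where V: "\<And>n. cozero_in T (V n)" "\<And>n. V n \<subseteq> U n" "C - U k \<subseteq> (\<Union>n<k. V n)"
    using Suc.IH[OF _ Suc.prems(2)] by metis
  have "closedin T (C - (\<Union>n<k. V n))"
    using Suc.prems(1) V(1) cozero_in_openin by blast
  moreover have "C - (\<Union>n<k. V n) \<subseteq> U k" using V(3) by blast
  ultimately obtain W where W: "cozero_in T W" "C - (\<Union>n<k. V n) \<subseteq> W" "W \<subseteq> U k"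
    using cozero_between[OF assms _ Suc.prems(2)] by metis
  show ?case
    by (rule exI[of _ "V(k := W)"]) (use V W in \<open>auto simp: lessThan_Suc\<close>)
qed

section \<open>The regular image of a probability measure under a Baire measurable map\<close>

lemma regular_borel_probabilityD:
  assumes "regular_borel_probability T \<mu>"
  shows "space \<mu> = topspace T"
    and "prob_space \<mu>"
    and "sets \<mu> = sigma_sets (topspace T) {U. openin T U}"
    and "openin T U \<Longrightarrow> U \<in> sets \<mu>"
    and "A \<in> sets \<mu> \<Longrightarrow> emeasure \<mu> A = (INF U\<in>{U. openin T U \<and> A \<subseteq> U}. emeasure \<mu> U)"
    and "A \<in> sets \<mu> \<Longrightarrow> emeasure \<mu> A = (SUP C\<in>{C. compactin T C \<and> C \<subseteq> A}. emeasure \<mu> C)"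
  using assms unfolding regular_borel_probability_def by (blast intro: sigma_sets.Basic)+

lemma borel_measurable_continuous_map_real:
  assumes "regular_borel_probability T \<mu>" and F: "continuous_map T euclideanreal F"
  shows "F \<in> borel_measurable \<mu>"
proof (rule borel_measurableI_greater)
  fix c
  show "{x \<in> space \<mu>. c < F x} \<in> sets \<mu>"
    unfolding regular_borel_probabilityD(1)[OF assms(1)]
    by (rule regular_borel_probabilityD(4)[OF assms(1) openin_superlevel[OF F]])
qed

text \<open>
  A map that pulls continuous functions, but possibly not open sets, back to measurable
  ones. Its image measure is defined only on the Baire sets, and the construction
  below is its regular Borel extension.
\<close>

locale Baire_measurable_map = N: prob_space N for N :: "'b measure" +
  fixes T :: "'a topology" and j :: "'b \<Rightarrow> 'a"
  assumes compact: "compact_space T" and Hausdorff: "Hausdorff_space T"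
    and j_space: "j \<in> space N \<rightarrow> topspace T"
    and j_measurable: "\<And>F. continuous_map T euclideanreal F \<Longrightarrow> (\<lambda>y. F (j y)) \<in> borel_measurable N"
begin

lemma normal: "normal_space T"
  using compact Hausdorff compact_Hausdorff_or_regular_imp_normal_space by blast

definition image_mass :: "'a set \<Rightarrow> ennreal" where
  "image_mass V = emeasure N (j -` V \<inter> space N)"

definition open_mass :: "'a set \<Rightarrow> ennreal" where
  "open_mass U = (SUP V\<in>{V. cozero_in T V \<and> V \<subseteq> U}. image_mass V)"

definition outer_mass :: "'a set \<Rightarrow> ennreal" where
  "outer_mass A = (INF U\<in>{U. openin T U \<and> A \<subseteq> U}. open_mass U)"

lemma superlevel_sets:
  assumes "continuous_map T euclideanreal F"
  shows "j -` {x\<in>topspace T. c < F x} \<inter> space N \<in> sets N"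
proof -
  have "j -` {x\<in>topspace T. c < F x} \<inter> space N = {y\<in>space N. c < F (j y)}"
    using j_space by auto
  moreover have "{y\<in>space N. c < F (j y)} \<in> sets N"
    using j_measurable[OF assms] by measurable
  ultimately show ?thesis by simp
qed

lemma cozero_sets: "cozero_in T V \<Longrightarrow> j -` V \<inter> space N \<in> sets N"
  unfolding cozero_in_def using superlevel_sets by blast

lemma image_mass_mono: "cozero_in T W \<Longrightarrow> V \<subseteq> W \<Longrightarrow> image_mass V \<le> image_mass W"
  unfolding image_mass_def by (intro emeasure_mono cozero_sets) auto

lemma open_mass_cozero: "cozero_in T V \<Longrightarrow> open_mass V = image_mass V"
  unfolding open_mass_def
  by (intro antisym SUP_least SUP_upper) (auto intro: image_mass_mono)

lemma open_mass_mono: "U \<subseteq> W \<Longrightarrow> open_mass U \<le> open_mass W"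
  unfolding open_mass_def by (intro SUP_subset_mono) auto

lemma image_mass_le_open_mass: "cozero_in T V \<Longrightarrow> V \<subseteq> U \<Longrightarrow> image_mass V \<le> open_mass U"
  unfolding open_mass_def by (intro SUP_upper) auto

lemma outer_mass_mono: "A \<subseteq> B \<Longrightarrow> outer_mass A \<le> outer_mass B"
  unfolding outer_mass_def by (intro INF_superset_mono) auto

lemma outer_mass_open: "openin T U \<Longrightarrow> outer_mass U = open_mass U"
  unfolding outer_mass_def by (intro antisym INF_greatest INF_lower open_mass_mono) auto

lemma outer_mass_cozero: "cozero_in T V \<Longrightarrow> outer_mass V = image_mass V"
  by (simp add: outer_mass_open open_mass_cozero cozero_in_openin)

text \<open>
  The room between \<open>{F > 1/m}\<close> and \<open>{F > 0}\<close> holds the closed set \<open>{F \<ge> 1/m}\<close>. Its compactness gives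
  countable subadditivity below, and its open complement gives Caratheodory's criterion.
\<close>

lemma image_mass_exhaustion:
  assumes F: "continuous_map T euclideanreal F"
  shows "image_mass {x\<in>topspace T. 0 < F x} = (SUP m. image_mass {x\<in>topspace T. 1 / real (Suc m) < F x})"
proof -
  let ?A = "\<lambda>m. j -` {x\<in>topspace T. 1 / real (Suc m) < F x} \<inter> space N"
  have "incseq ?A"
  proof (rule incseq_SucI)
    fix m
    have "1 / real (Suc (Suc m)) \<le> 1 / real (Suc m)" by (simp add: field_simps)
    then show "?A m \<subseteq> ?A (Suc m)" by auto
  qed
  then have "(SUP m. emeasure N (?A m)) = emeasure N (\<Union>m. ?A m)"
    using superlevel_sets[OF F] by (intro SUP_emeasure_incseq) auto
  also have "(\<Union>m. ?A m) = j -` {x\<in>topspace T. 0 < F x} \<inter> space N"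
  proof (intro equalityI subsetI)
    fix y assume "y \<in> (\<Union>m. ?A m)"
    then obtain m where "y \<in> ?A m" by blast
    then have "0 < F (j y)" by (auto intro: less_trans[of 0 "1 / real (Suc m)"])
    then show "y \<in> j -` {x\<in>topspace T. 0 < F x} \<inter> space N" using \<open>y \<in> ?A m\<close> by auto
  next
    fix y assume y: "y \<in> j -` {x\<in>topspace T. 0 < F x} \<inter> space N"
    then obtain m where "inverse (real (Suc m)) < F (j y)" using reals_Archimedean by auto
    then show "y \<in> (\<Union>m. ?A m)" using y by (auto simp: inverse_eq_divide)
  qed
  finally show ?thesis by (simp add: image_mass_def)
qed

text \<open>
  Inside a cozero subset \<open>{F > 0}\<close> of the union, each compact set \<open>{F \<ge> 1/m}\<close> is covered by finitely many
  of the open sets, hence by finitely many cozero sets inside them.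
\<close>

lemma open_mass_countably_subadditive:
  assumes U: "\<And>n::nat. openin T (U n)"
  shows "open_mass (\<Union>n. U n) \<le> (\<Sum>n. open_mass (U n))"
  unfolding open_mass_def[of "\<Union>n. U n"]
proof (rule SUP_least, clarify)
  fix V assume "cozero_in T V" and VU: "V \<subseteq> (\<Union>n. U n)"
  then obtain F where F: "continuous_map T euclideanreal F" "V = {x\<in>topspace T. 0 < F x}"
    unfolding cozero_in_def by blast
  have "image_mass {x\<in>topspace T. 1 / real (Suc m) < F x} \<le> (\<Sum>n. open_mass (U n))" for m
  proof -
    let ?C = "{x\<in>topspace T. 1 / real (Suc m) \<le> F x}"
    have C: "closedin T ?C" by (rule closedin_superlevel[OF F(1)])
    then have "compactin T ?C" using compact closedin_compact_space by blast
    have CV: "?C \<subseteq> V" unfolding F(2) by (auto intro: less_le_trans[of 0 "1 / real (Suc m)"])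
    moreover have "?C \<subseteq> \<Union>(range U)" using CV VU by blast
    ultimately obtain \<F> where "finite \<F>" "\<F> \<subseteq> range U" "?C \<subseteq> \<Union>\<F>"
      using \<open>compactin T ?C\<close> U unfolding compactin_def by (metis (no_types, lifting) imageE)
    then obtain I where I: "finite I" "?C \<subseteq> (\<Union>n\<in>I. U n)"
      using finite_subset_image[of \<F> U UNIV] by metis
    obtain k where k: "I \<subseteq> {..<k}" using I(1) finite_nat_iff_bounded by blast
    have "?C \<subseteq> (\<Union>n<k. U n)" using I k by blast
    from cozero_cover_shrinking[OF normal C U this]
    obtain W where W: "\<And>n. cozero_in T (W n)" "\<And>n. W n \<subseteq> U n" "?C \<subseteq> (\<Union>n<k. W n)" by blast
    have "image_mass {x\<in>topspace T. 1 / real (Suc m) < F x}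
        \<le> emeasure N (\<Union>n\<in>{..<k}. j -` W n \<inter> space N)"
      unfolding image_mass_def
    proof (rule emeasure_mono)
      show "j -` {x\<in>topspace T. 1 / real (Suc m) < F x} \<inter> space N \<subseteq> (\<Union>n\<in>{..<k}. j -` W n \<inter> space N)"
        using W(3) by (auto simp: subset_iff)
      show "(\<Union>n\<in>{..<k}. j -` W n \<inter> space N) \<in> sets N" using cozero_sets W(1) by blast
    qed
    also have "\<dots> \<le> (\<Sum>n<k. image_mass (W n))"
      unfolding image_mass_def using cozero_sets W(1) by (intro emeasure_subadditive_finite) auto
    also have "\<dots> \<le> (\<Sum>n<k. open_mass (U n))"
      using W by (intro sum_mono image_mass_le_open_mass)
    also have "\<dots> \<le> (\<Sum>n. open_mass (U n))" by (intro sum_le_suminf) auto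
    finally show ?thesis .
  qed
  then show "image_mass V \<le> (\<Sum>n. open_mass (U n))"
    unfolding F(2) image_mass_exhaustion[OF F(1)] by (rule SUP_least)
qed

lemma open_mass_le_1: "open_mass U \<le> 1"
  unfolding open_mass_def image_mass_def by (intro SUP_least N.emeasure_le_1)

lemma outer_mass_approx:
  assumes "A \<subseteq> topspace T" "0 < e"
  shows "\<exists>U. openin T U \<and> A \<subseteq> U \<and> open_mass U \<le> outer_mass A + ennreal e"
proof -
  have "outer_mass A \<le> open_mass (topspace T)"
    unfolding outer_mass_def using assms by (intro INF_lower) auto
  then have "outer_mass A \<noteq> \<top>" using open_mass_le_1[of "topspace T"]
    by (metis ennreal_one_less_top leD order_trans top.not_eq_extremum)
  then have "outer_mass A < outer_mass A + ennreal e" using assms(2) by simp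
  then show ?thesis
    unfolding outer_mass_def[of A] INF_less_iff by (auto intro: less_imp_le)
qed

lemma outer_measure_space_outer_mass: "outer_measure_space (Pow (topspace T)) outer_mass"
  unfolding outer_measure_space_def
proof (intro conjI)
  have "outer_mass {} = 0"
    by (simp add: outer_mass_cozero cozero_in_empty image_mass_def)
  then show "positive (Pow (topspace T)) outer_mass" by (simp add: positive_def)
  show "increasing (Pow (topspace T)) outer_mass" by (auto simp: increasing_def intro: outer_mass_mono)
  show "countably_subadditive (Pow (topspace T)) outer_mass"
    unfolding countably_subadditive_def
  proof (intro allI impI)
    fix A :: "nat \<Rightarrow> 'a set"
    assume A: "range A \<subseteq> Pow (topspace T)"
    show "outer_mass (\<Union>i. A i) \<le> (\<Sum>i. outer_mass (A i))"
    proof (rule ennreal_le_epsilon)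
      fix e :: real assume e: "0 < e"
      have "\<exists>U. openin T U \<and> A n \<subseteq> U \<and> open_mass U \<le> outer_mass (A n) + ennreal (e * (1/2)^Suc n)" for n
        using A e by (intro outer_mass_approx) auto
      then obtain U where U: "\<And>n. openin T (U n)" "\<And>n. A n \<subseteq> U n"
          "\<And>n. open_mass (U n) \<le> outer_mass (A n) + ennreal (e * (1/2)^Suc n)"
        by metis
      have "outer_mass (\<Union>i. A i) \<le> outer_mass (\<Union>i. U i)"
        using U(2) by (intro outer_mass_mono) blast
      also have "\<dots> = open_mass (\<Union>i. U i)"
        using U(1) by (intro outer_mass_open openin_Union) auto
      also have "\<dots> \<le> (\<Sum>i. open_mass (U i))" by (rule open_mass_countably_subadditive[OF U(1)])
      also have "\<dots> \<le> (\<Sum>i. outer_mass (A i) + ennreal (e * (1/2)^Suc i))"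
        using U(3) by (intro suminf_le) auto
      also have "\<dots> = (\<Sum>i. outer_mass (A i)) + (\<Sum>i. ennreal e * ennreal ((1/2)^Suc i))"
        using e by (subst suminf_add[symmetric])
          (auto simp del: ennreal_suminf_cmult simp add: ennreal_mult[symmetric])
      also have "\<dots> = (\<Sum>i. outer_mass (A i)) + ennreal e"
        unfolding ennreal_suminf_cmult
        by (subst suminf_ennreal_eq[OF zero_le_power power_half_series]) auto
      finally show "outer_mass (\<Union>i. A i) \<le> (\<Sum>i. outer_mass (A i)) + ennreal e" .
    qed
  qed
qed

lemma image_mass_Un_disjoint:
  assumes "cozero_in T V" "cozero_in T W" "V \<inter> W = {}"
  shows "image_mass V + image_mass W = image_mass (V \<union> W)"
  unfolding image_mass_def vimage_Un Int_Un_distrib2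
  using assms cozero_sets by (intro plus_emeasure) auto

text \<open>
  Let \<open>V = {F > 0}\<close> be a cozero subset of \<open>U \<inter> H\<close>. The open set \<open>U - {F \<ge> 1/m}\<close> contains \<open>U - H\<close> and is disjoint
  from \<open>{F > 1/m}\<close>, so the mass of \<open>{F > 1/m}\<close> and the mass of \<open>U - H\<close> add up to at most that of \<open>U\<close>.
  This is Caratheodory's criterion for the open set \<open>H\<close>, tested on open sets.
\<close>

lemma open_mass_split:
  assumes U: "openin T U" and H: "openin T H"
  shows "open_mass (U \<inter> H) + outer_mass (U - H) \<le> open_mass U"
proof -
  have "image_mass V + outer_mass (U - H) \<le> open_mass U" if V: "cozero_in T V" "V \<subseteq> U \<inter> H" for V
  proof -
    obtain F where F: "continuous_map T euclideanreal F" "V = {x\<in>topspace T. 0 < F x}"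
      using V unfolding cozero_in_def by blast
    have "image_mass {x\<in>topspace T. 1 / real (Suc m) < F x} + outer_mass (U - H) \<le> open_mass U" for m
    proof -
      let ?V = "{x\<in>topspace T. 1 / real (Suc m) < F x}"
      let ?C = "{x\<in>topspace T. 1 / real (Suc m) \<le> F x}"
      have CV: "?C \<subseteq> V" unfolding F(2) by (auto intro: less_le_trans[of 0 "1 / real (Suc m)"])
      have cz: "cozero_in T ?V" by (rule cozero_in_superlevel[OF F(1)])
      have op: "openin T (U - ?C)" using U closedin_superlevel[OF F(1)] by blast
      have "outer_mass (U - H) \<le> outer_mass (U - ?C)" using CV V(2) by (intro outer_mass_mono) blast
      also have "\<dots> = open_mass (U - ?C)" by (rule outer_mass_open[OF op])
      finally have "image_mass ?V + outer_mass (U - H) \<le> image_mass ?V + open_mass (U - ?C)"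
        by (intro add_left_mono)
      also have "\<dots> = (SUP W\<in>{W. cozero_in T W \<and> W \<subseteq> U - ?C}. image_mass ?V + image_mass W)"
        unfolding open_mass_def by (rule ennreal_SUP_add_right) (use cozero_in_empty in blast)
      also have "\<dots> \<le> open_mass U"
      proof (rule SUP_least, clarify)
        fix W assume W: "cozero_in T W" "W \<subseteq> U - ?C"
        have "?V \<inter> W = {}" "?V \<union> W \<subseteq> U" using W(2) CV V(2) by auto
        then show "image_mass ?V + image_mass W \<le> open_mass U"
          using cz W(1) by (simp add: image_mass_Un_disjoint image_mass_le_open_mass cozero_in_Un)
      qed
      finally show ?thesis .
    qed
    then have "(SUP m. image_mass {x\<in>topspace T. 1 / real (Suc m) < F x} + outer_mass (U - H)) \<le> open_mass U"
      by (rule SUP_least)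
    then show ?thesis
      unfolding F(2) image_mass_exhaustion[OF F(1)] by (simp add: ennreal_SUP_add_left)
  qed
  then have "(SUP V\<in>{V. cozero_in T V \<and> V \<subseteq> U \<inter> H}. image_mass V + outer_mass (U - H)) \<le> open_mass U"
    by (intro SUP_least) auto
  moreover have "{V. cozero_in T V \<and> V \<subseteq> U \<inter> H} \<noteq> {}" using cozero_in_empty by blast
  ultimately show ?thesis
    unfolding open_mass_def[of "U \<inter> H"] by (simp add: ennreal_SUP_add_left)
qed

lemma open_in_lambda_system:
  assumes H: "openin T H"
  shows "H \<in> lambda_system (topspace T) (Pow (topspace T)) outer_mass"
proof -
  interpret P: sigma_algebra "topspace T" "Pow (topspace T)" by (rule sigma_algebra_Pow)
  have "outer_mass (A \<inter> H) + outer_mass (A - H) = outer_mass A" if A: "A \<subseteq> topspace T" for A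
  proof (rule antisym)
    have "outer_mass (A \<inter> H) + outer_mass (A - H) \<le> open_mass U" if U: "openin T U" "A \<subseteq> U" for U
    proof -
      have "outer_mass (A \<inter> H) \<le> outer_mass (U \<inter> H)" "outer_mass (A - H) \<le> outer_mass (U - H)"
        using U(2) by (auto intro!: outer_mass_mono)
      moreover have "outer_mass (U \<inter> H) = open_mass (U \<inter> H)" using U H by (intro outer_mass_open) auto
      ultimately have "outer_mass (A \<inter> H) + outer_mass (A - H) \<le> open_mass (U \<inter> H) + outer_mass (U - H)"
        by (simp add: add_mono)
      also have "\<dots> \<le> open_mass U" by (rule open_mass_split[OF U(1) H])
      finally show ?thesis .
    qed
    then show "outer_mass (A \<inter> H) + outer_mass (A - H) \<le> outer_mass A"
      unfolding outer_mass_def[of A] by (intro INF_greatest) auto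
    have "subadditive (Pow (topspace T)) outer_mass"
      using outer_measure_space_outer_mass P.countably_subadditive_subadditive
      unfolding outer_measure_space_def by blast
    then have "outer_mass ((A \<inter> H) \<union> (A - H)) \<le> outer_mass (A \<inter> H) + outer_mass (A - H)"
      using A by (intro subadditiveD) auto
    then show "outer_mass A \<le> outer_mass (A \<inter> H) + outer_mass (A - H)" by (simp only: Int_Diff_Un)
  qed
  then show ?thesis
    unfolding P.lambda_system_eq using openin_subset[OF H] by auto
qed

definition regular_image :: "'a measure" where
  "regular_image = measure_of (topspace T) {U. openin T U} outer_mass"

lemma opens_Pow: "{U. openin T U} \<subseteq> Pow (topspace T)"
  using openin_subset by blast

lemma space_regular_image: "space regular_image = topspace T"
  unfolding regular_image_def using opens_Pow by (rule space_measure_of)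

lemma sets_regular_image: "sets regular_image = sigma_sets (topspace T) {U. openin T U}"
  unfolding regular_image_def using opens_Pow by (rule sets_measure_of)

lemma emeasure_regular_image:
  assumes "A \<in> sets regular_image"
  shows "emeasure regular_image A = outer_mass A"
proof -
  interpret P: sigma_algebra "topspace T" "Pow (topspace T)" by (rule sigma_algebra_Pow)
  let ?L = "lambda_system (topspace T) (Pow (topspace T)) outer_mass"
  have ms: "measure_space (topspace T) ?L outer_mass"
    by (rule P.caratheodory_lemma[OF outer_measure_space_outer_mass])
  then interpret L: sigma_algebra "topspace T" ?L by (simp add: measure_space_def)
  have "sigma_sets (topspace T) {U. openin T U} \<subseteq> ?L"
    using open_in_lambda_system by (intro L.sigma_sets_subset) auto
  then have "measure_space (topspace T) (sigma_sets (topspace T) {U. openin T U}) outer_mass"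
    using measure_down[OF ms] sigma_algebra_sigma_sets[OF opens_Pow] by blast
  then show ?thesis
    using emeasure_measure_of[OF regular_image_def opens_Pow, of A] assms
    by (simp add: measure_space_def sets_regular_image)
qed

lemma open_sets_regular_image: "openin T U \<Longrightarrow> U \<in> sets regular_image"
  by (simp add: sets_regular_image sigma_sets.Basic)

lemma emeasure_regular_image_cozero:
  "cozero_in T V \<Longrightarrow> emeasure regular_image V = image_mass V"
  by (simp add: emeasure_regular_image open_sets_regular_image cozero_in_openin outer_mass_cozero)

lemma prob_space_regular_image: "prob_space regular_image"
proof (rule prob_spaceI)
  have "j -` topspace T \<inter> space N = space N" using j_space by auto
  then show "emeasure regular_image (space regular_image) = 1"
    by (simp add: space_regular_image emeasure_regular_image_cozero cozero_in_topspace
        image_mass_def N.emeasure_space_1)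
qed

lemma regular_borel_probability_regular_image: "regular_borel_probability T regular_image"
  unfolding regular_borel_probability_def
proof (intro conjI ballI)
  let ?\<mu> = "regular_image"
  interpret R: prob_space ?\<mu> by (rule prob_space_regular_image)
  show "space ?\<mu> = topspace T" by (rule space_regular_image)
  show "sets ?\<mu> = sigma_sets (topspace T) {U. openin T U}" by (rule sets_regular_image)
  show "prob_space ?\<mu>" by (rule prob_space_regular_image)
  have outer: "emeasure ?\<mu> A = (INF U\<in>{U. openin T U \<and> A \<subseteq> U}. emeasure ?\<mu> U)" if "A \<in> sets ?\<mu>" for A
    unfolding emeasure_regular_image[OF that] outer_mass_def[of A]
    by (intro INF_cong) (auto simp: emeasure_regular_image open_sets_regular_image outer_mass_open)
  fix A assume A: "A \<in> sets ?\<mu>"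
  show "emeasure ?\<mu> A = (INF U\<in>{U. openin T U \<and> A \<subseteq> U}. emeasure ?\<mu> U)" by (rule outer[OF A])
  show "emeasure ?\<mu> A = (SUP C\<in>{C. compactin T C \<and> C \<subseteq> A}. emeasure ?\<mu> C)"
  proof (rule antisym)
    let ?S = "SUP C\<in>{C. compactin T C \<and> C \<subseteq> A}. emeasure ?\<mu> C"
    have A': "topspace T - A \<in> sets ?\<mu>" using sets.compl_sets[OF A] by (simp add: space_regular_image)
    have AT: "A \<subseteq> topspace T" using sets.sets_into_space[OF A] by (simp add: space_regular_image)
    \<comment> \<open>Inner regularity of \<open>A\<close> is outer regularity of its complement.\<close>
    have le: "1 \<le> ?S + emeasure ?\<mu> U" if U: "openin T U" "topspace T - A \<subseteq> U" for U
    proof -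
      let ?C = "topspace T - U"
      have "closedin T ?C" using U by blast
      then have "compactin T ?C" using compact closedin_compact_space by blast
      moreover have "?C \<subseteq> A" using U by blast
      ultimately have "emeasure ?\<mu> ?C \<le> ?S" by (intro SUP_upper) auto
      moreover have "emeasure ?\<mu> ?C + emeasure ?\<mu> U = 1"
      proof -
        have "?C \<in> sets ?\<mu>" using sets.compl_sets[OF open_sets_regular_image[OF U(1)]]
          by (simp add: space_regular_image)
        then have "emeasure ?\<mu> ?C + emeasure ?\<mu> U = emeasure ?\<mu> (?C \<union> U)"
          using open_sets_regular_image[OF U(1)] by (intro plus_emeasure) auto
        also have "?C \<union> U = space ?\<mu>" using openin_subset[OF U(1)] by (auto simp: space_regular_image)
        finally show ?thesis by (simp add: R.emeasure_space_1)
      qed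
      ultimately show ?thesis by (metis add_right_mono)
    qed
    have "1 - ?S \<le> emeasure ?\<mu> (topspace T - A)"
      unfolding outer[OF A'] using le by (intro INF_greatest) (simp add: ennreal_minus_le_iff)
    then have "1 \<le> ?S + emeasure ?\<mu> (topspace T - A)"
      by (simp add: ennreal_minus_le_iff)
    moreover have "emeasure ?\<mu> A + emeasure ?\<mu> (topspace T - A) = 1"
      using plus_emeasure[OF A A'] AT R.emeasure_space_1 by (simp add: space_regular_image Un_absorb1)
    ultimately have "emeasure ?\<mu> (topspace T - A) + emeasure ?\<mu> A \<le> emeasure ?\<mu> (topspace T - A) + ?S"
      by (simp only: add.commute)
    then show "emeasure ?\<mu> A \<le> ?S"
      unfolding ennreal_add_left_cancel_le using R.emeasure_finite by auto
    show "?S \<le> emeasure ?\<mu> A" using A by (intro SUP_least emeasure_mono) auto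
  qed
qed

lemma borel_measurable_regular_image:
  "continuous_map T euclideanreal F \<Longrightarrow> F \<in> borel_measurable regular_image"
  by (rule borel_measurable_continuous_map_real[OF regular_borel_probability_regular_image])

text \<open>
  The half-lines \<open>{c<..}\<close> pull back under \<open>F\<close> to cozero sets, on which the regular image has the mass of
  the preimage under \<open>j\<close>. So \<open>F\<close> and \<open>F \<circ> j\<close> have the same distribution.
\<close>

lemma integral_regular_image:
  assumes F: "continuous_map T euclideanreal F"
  shows "integral\<^sup>L regular_image F = (\<integral>y. F (j y) \<partial>N)"
proof -
  interpret R: prob_space regular_image by (rule prob_space_regular_image)
  have "distr regular_image borel F = distr N borel (\<lambda>y. F (j y))"
  proof (rule measure_eqI_generator_eq[where E = "range (\<lambda>c::real. {c<..})" and A = "\<lambda>i. {- real i<..}" and \<Omega> = UNIV])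
    show "Int_stable (range (\<lambda>c::real. {c<..}))"
    proof -
      have "{a<..} \<inter> {b<..} = {max a b<..}" for a b :: real by auto
      then show ?thesis by (auto simp: Int_stable_def)
    qed
    show "sets (distr regular_image borel F) = sigma_sets UNIV (range (\<lambda>c::real. {c<..}))"
      "sets (distr N borel (\<lambda>y. F (j y))) = sigma_sets UNIV (range (\<lambda>c::real. {c<..}))"
      by (simp_all add: borel_Ioi)
    show "(\<Union>i. {- real i<..}) = UNIV"
    proof (intro equalityI subsetI UNIV_I)
      fix x :: real
      obtain n where "- x < real n" using reals_Archimedean2 by blast
      then have "x \<in> {- real n<..}" by simp
      then show "x \<in> (\<Union>i. {- real i<..})" by blast
    qed
    fix X :: "real set" assume "X \<in> range (\<lambda>c::real. {c<..})"
    then obtain c where X: "X = {c<..}" by blast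
    have eq: "F -` X \<inter> topspace T = {x\<in>topspace T. c < F x}" by (auto simp: X)
    have "emeasure (distr regular_image borel F) X = image_mass {x\<in>topspace T. c < F x}"
      using borel_measurable_regular_image[OF F] emeasure_regular_image_cozero[OF cozero_in_superlevel[OF F, of c]] eq
      by (simp add: emeasure_distr X space_regular_image)
    also have "\<dots> = emeasure N ((\<lambda>y. F (j y)) -` X \<inter> space N)"
      unfolding image_mass_def using j_space by (intro arg_cong[of _ _ "emeasure N"]) (auto simp: X)
    also have "\<dots> = emeasure (distr N borel (\<lambda>y. F (j y))) X"
      using j_measurable[OF F] by (simp add: emeasure_distr X)
    finally show "emeasure (distr regular_image borel F) X = emeasure (distr N borel (\<lambda>y. F (j y))) X" .
  next
    fix i :: nat
    show "emeasure (distr regular_image borel F) {- real i<..} \<noteq> \<infinity>"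
      using prob_space.emeasure_le_1[OF R.prob_space_distr[OF borel_measurable_regular_image[OF F]], of "{- real i<..}"]
      by (auto simp: top_unique)
  qed auto
  then have "(\<integral>x. x \<partial>distr regular_image borel F) = (\<integral>x. x \<partial>distr N borel (\<lambda>y. F (j y)))" by simp
  then show ?thesis
    using borel_measurable_regular_image[OF F] j_measurable[OF F] by (simp add: integral_distr)
qed

end

section \<open>Uniqueness of regular measures\<close>

lemma cozero_LIMSEQ_integral:
  assumes \<mu>: "regular_borel_probability T \<mu>" and F: "continuous_map T euclideanreal F"
  shows "(\<lambda>n. \<integral>x. min 1 (real n * max 0 (F x)) \<partial>\<mu>) \<longlonglongrightarrow> measure \<mu> {x\<in>topspace T. 0 < F x}"
proof -
  interpret prob_space \<mu> by (rule regular_borel_probabilityD[OF \<mu>])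
  have sp: "space \<mu> = topspace T" by (rule regular_borel_probabilityD[OF \<mu>])
  let ?V = "{x\<in>topspace T. 0 < F x}"
  have [measurable]: "F \<in> borel_measurable \<mu>" by (rule borel_measurable_continuous_map_real[OF \<mu> F])
  have V: "?V \<in> sets \<mu>" unfolding sp[symmetric] by measurable
  have "(\<lambda>n. \<integral>x. min 1 (real n * max 0 (F x)) \<partial>\<mu>) \<longlonglongrightarrow> (\<integral>x. indicator ?V x \<partial>\<mu>)"
  proof (rule integral_dominated_convergence[where w = "\<lambda>_. 1"])
    show "AE x in \<mu>. (\<lambda>n. min 1 (real n * max 0 (F x))) \<longlonglongrightarrow> indicator ?V x"
    proof (rule AE_I2)
      fix x assume x: "x \<in> space \<mu>"
      show "(\<lambda>n. min 1 (real n * max 0 (F x))) \<longlonglongrightarrow> indicator ?V x"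
      proof (cases "0 < F x")
        case True
        obtain m where m: "1 / F x < real m" using reals_Archimedean2 by blast
        have "eventually (\<lambda>n. min 1 (real n * max 0 (F x)) = 1) sequentially"
        proof (rule eventually_sequentiallyI)
          fix n assume "m \<le> n"
          then have "1 / F x \<le> real n" using m by linarith
          then have "1 \<le> real n * F x" using True by (simp add: pos_divide_le_eq)
          then show "min 1 (real n * max 0 (F x)) = 1" using True by simp
        qed
        then show ?thesis using x True by (simp add: sp tendsto_eventually)
      qed (simp add: max_def)
    qed
    show "AE x in \<mu>. norm (min 1 (real n * max 0 (F x))) \<le> 1" for n by simp
  qed (use V in auto)
  then show ?thesis using V by simp
qed

text \<open>
  Inner regularity gives compact subsets of \<open>U\<close>, and Urysohn's lemma inserts a cozero set between
  each of them and \<open>U\<close>.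
\<close>

lemma emeasure_open_eq_SUP_cozero:
  assumes T: "compact_space T" "Hausdorff_space T" and \<mu>: "regular_borel_probability T \<mu>"
    and U: "openin T U"
  shows "emeasure \<mu> U = (SUP V\<in>{V. cozero_in T V \<and> V \<subseteq> U}. emeasure \<mu> V)"
proof (rule antisym)
  have nT: "normal_space T" using T compact_Hausdorff_or_regular_imp_normal_space by blast
  have open_sets: "openin T W \<Longrightarrow> W \<in> sets \<mu>" for W
    by (rule regular_borel_probabilityD(4)[OF \<mu>])
  have "emeasure \<mu> U = (SUP C\<in>{C. compactin T C \<and> C \<subseteq> U}. emeasure \<mu> C)"
    using regular_borel_probabilityD(6)[OF \<mu> open_sets[OF U]] .
  also have "\<dots> \<le> (SUP V\<in>{V. cozero_in T V \<and> V \<subseteq> U}. emeasure \<mu> V)"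
  proof (rule SUP_mono)
    fix C assume "C \<in> {C. compactin T C \<and> C \<subseteq> U}"
    then have C: "closedin T C" "C \<subseteq> U" using T(2) compactin_imp_closedin by auto
    from cozero_between[OF nT C(1) U C(2)]
    obtain V where V: "cozero_in T V" "C \<subseteq> V" "V \<subseteq> U" .
    then show "\<exists>V\<in>{V. cozero_in T V \<and> V \<subseteq> U}. emeasure \<mu> C \<le> emeasure \<mu> V"
      using open_sets[OF cozero_in_openin[OF V(1)]] emeasure_mono by blast
  qed
  finally show "emeasure \<mu> U \<le> (SUP V\<in>{V. cozero_in T V \<and> V \<subseteq> U}. emeasure \<mu> V)" .
  show "(SUP V\<in>{V. cozero_in T V \<and> V \<subseteq> U}. emeasure \<mu> V) \<le> emeasure \<mu> U"
    using open_sets[OF U] by (intro SUP_least emeasure_mono) auto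
qed

lemma regular_borel_probability_eqI:
  assumes T: "compact_space T" "Hausdorff_space T"
    and \<mu>: "regular_borel_probability T \<mu>" and \<nu>: "regular_borel_probability T \<nu>"
    and eq: "\<And>F. continuous_map T euclideanreal F \<Longrightarrow> integral\<^sup>L \<mu> F = integral\<^sup>L \<nu> F"
  shows "\<mu> = \<nu>"
proof (rule measure_eqI)
  interpret \<mu>: prob_space \<mu> by (rule regular_borel_probabilityD[OF \<mu>])
  interpret \<nu>: prob_space \<nu> by (rule regular_borel_probabilityD[OF \<nu>])
  show sets_eq: "sets \<mu> = sets \<nu>" by (simp only: regular_borel_probabilityD(3)[OF \<mu>] regular_borel_probabilityD(3)[OF \<nu>])
  have cozero: "emeasure \<mu> V = emeasure \<nu> V" if V: "cozero_in T V" for V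
  proof -
    obtain F where F: "continuous_map T euclideanreal F" "V = {x\<in>topspace T. 0 < F x}"
      using V unfolding cozero_in_def by blast
    have "(\<integral>x. min 1 (real n * max 0 (F x)) \<partial>\<mu>) = (\<integral>x. min 1 (real n * max 0 (F x)) \<partial>\<nu>)" for n
      using F(1) by (intro eq continuous_map_real_min continuous_map_real_max continuous_map_real_mult) auto
    then have "measure \<mu> V = measure \<nu> V"
      using cozero_LIMSEQ_integral[OF \<mu> F(1)] cozero_LIMSEQ_integral[OF \<nu> F(1)] F(2)
      by (simp add: LIMSEQ_unique)
    then show ?thesis by (simp add: \<mu>.emeasure_eq_measure \<nu>.emeasure_eq_measure)
  qed
  have "emeasure \<mu> U = emeasure \<nu> U" if "openin T U" for U
    unfolding emeasure_open_eq_SUP_cozero[OF T \<mu> that] emeasure_open_eq_SUP_cozero[OF T \<nu> that]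
    by (intro SUP_cong) (auto simp: cozero)
  then have "(INF U\<in>{U. openin T U \<and> A \<subseteq> U}. emeasure \<mu> U) = (INF U\<in>{U. openin T U \<and> A \<subseteq> U}. emeasure \<nu> U)" for A
    by (intro INF_cong) auto
  then show "emeasure \<mu> A = emeasure \<nu> A" if "A \<in> sets \<mu>" for A
    using regular_borel_probabilityD(5)[OF \<mu> that] regular_borel_probabilityD(5)[OF \<nu>, of A] that sets_eq
    by simp
qed

section \<open>Fragmented maps on quotients of compact spaces\<close>

text \<open>
  Here \<open>\<pi>\<close> is a quotient map from a compact space \<open>P\<close>, and \<open>w \<circ> h\<close> stands for a map that is known on \<open>P\<close>
  only. The set \<open>Z\<close> of the proof is minimal with respect to the measure of its image, so removing a
  nonempty relatively open piece from \<open>Z\<close> lowers that measure: the piece leaves a trace of positive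
  measure in the quotient. The conclusion mentions points of \<open>P\<close> over \<open>d\<close> and \<open>d'\<close> because
  \<open>w \<circ> h\<close> need not factor through \<open>\<pi>\<close>.
\<close>

lemma fragmented_quotient_small_oscillation:
  fixes P :: "'p::t2_space set" and h :: "'p \<Rightarrow> 'y::topological_space" and w :: "'y \<Rightarrow> 'z::uniform_space"
  assumes P: "compact P" and \<pi>: "continuous_map (top_of_set P) T \<pi>" "topspace T \<subseteq> \<pi> ` P"
    and T: "Hausdorff_space T" and \<nu>: "regular_borel_probability T \<nu>"
    and h: "continuous_on P h" and w: "fragmented_map w"
    and V: "eventually (\<lambda>z. z \<in> V) uniformity"
    and A: "A \<in> sets \<nu>" "0 < emeasure \<nu> A"
  shows "\<exists>D\<in>sets \<nu>. D \<subseteq> A \<and> 0 < emeasure \<nu> D \<and>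
    (\<forall>d\<in>D. \<forall>d'\<in>D. \<exists>p\<in>P. \<exists>q\<in>P. \<pi> p = d \<and> \<pi> q = d' \<and> (w (h p), w (h q)) \<in> V)"
proof -
  interpret prob_space \<nu> by (rule regular_borel_probabilityD[OF \<nu>])
  have open_sets: "openin T W \<Longrightarrow> W \<in> sets \<nu>" for W
    by (rule regular_borel_probabilityD(4)[OF \<nu>])
  have closed_sets: "W \<in> sets \<nu>" if "closedin T W" for W
  proof -
    have "topspace T - (topspace T - W) \<in> sets \<nu>"
      using open_sets[of "topspace T - W"] sets.compl_sets[of "topspace T - W" \<nu>] that
      by (simp add: regular_borel_probabilityD(1)[OF \<nu>] closedin_def)
    then show ?thesis using closedin_subset[OF that] by (simp add: double_diff)
  qed
  have image_closed: "closedin T (\<pi> ` Z)" if "compact Z" "Z \<subseteq> P" for Z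
    using image_compactin[OF _ \<pi>(1), of Z] that T
    by (simp add: compactin_subtopology compactin_imp_closedin)
  have image_sets: "\<pi> ` Z \<in> sets \<nu>" if "compact Z" "Z \<subseteq> P" for Z
    using image_closed closed_sets that by blast
  have "0 < (SUP C\<in>{C. compactin T C \<and> C \<subseteq> A}. emeasure \<nu> C)"
    using regular_borel_probabilityD(6)[OF \<nu> A(1)] A(2) by simp
  then obtain C where C: "compactin T C" "C \<subseteq> A" "0 < emeasure \<nu> C"
    unfolding less_SUP_iff by blast
  have clC: "closedin T C" using C T compactin_imp_closedin by blast
  \<comment> \<open>The members of \<open>Q\<close> are the complements in \<open>P\<close> of the candidates for \<open>Z\<close>, so a maximal member gives a minimal \<open>Z\<close>.\<close>
  define Q where "Q = {W. W \<subseteq> P \<and> compact (P - W) \<and> \<pi> ` (P - W) \<subseteq> C \<and>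
      emeasure \<nu> C \<le> emeasure \<nu> (\<pi> ` (P - W))}"
  have "\<exists>W\<in>Q. \<forall>X\<in>Q. W \<subseteq> X \<longrightarrow> X = W"
  proof (rule subset_Zorn_nonempty)
    let ?Z = "{p\<in>P. \<pi> p \<in> C}"
    have "closedin (top_of_set P) ?Z"
      using closedin_continuous_map_preimage[OF \<pi>(1) clC] by simp
    then have "compact ?Z" using P closedin_compact by blast
    moreover have "\<pi> ` ?Z = C" using \<pi>(2) closedin_subset[OF clC] by blast
    moreover have "P - (P - ?Z) = ?Z" by blast
    ultimately have "P - ?Z \<in> Q" by (simp add: Q_def)
    then show "Q \<noteq> {}" by blast
  next
    fix \<C> assume ne: "\<C> \<noteq> {}" and ch: "subset.chain Q \<C>"
    have CQ: "\<C> \<subseteq> Q" using ch by (simp add: subset.chain_def)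
    have eq: "P - \<Union>\<C> = P \<inter> (\<Inter>W\<in>\<C>. P - W)" using ne by blast
    have cl: "closed (P - W)" if "W \<in> \<C>" for W using CQ that by (auto simp: Q_def intro: compact_imp_closed)
    have cpt: "compact (P - \<Union>\<C>)"
      unfolding eq using P cl by (intro compact_Int_closed closed_INT) auto
    \<comment> \<open>By compactness the complement of some member of the chain already maps into \<open>U\<close>,
        so outer regularity passes the bound on to the intersection of the complements.\<close>
    have "emeasure \<nu> C \<le> emeasure \<nu> U" if U: "openin T U" "\<pi> ` (P - \<Union>\<C>) \<subseteq> U" for U
    proof -
      let ?R = "{p\<in>P. \<pi> p \<in> topspace T - U}"
      have "closedin (top_of_set P) ?R"
        using closedin_continuous_map_preimage[OF \<pi>(1), of "topspace T - U"] U by auto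
      then have R: "compact ?R" using P closedin_compact by blast
      have "?R \<subseteq> \<Union>((\<lambda>W. - (P - W)) ` \<C>)" using U(2) by auto
      then obtain \<B> where B: "finite \<B>" "\<B> \<subseteq> \<C>" "?R \<subseteq> (\<Union>W\<in>\<B>. - (P - W))"
        using compactE_image[OF R, of \<C> "\<lambda>W. - (P - W)"] cl by (metis open_Compl)
      obtain W where W: "W \<in> \<C>" "?R \<subseteq> W"
      proof (cases "\<B> = {}")
        case True
        then show thesis using that ne B(3) by blast
      next
        case False
        have "subset.chain Q \<B>" using ch B(2) unfolding subset.chain_def by (meson subset_iff)
        then have "\<Union>\<B> \<in> \<B>" using Union_in_chain[OF B(1) False] by blast
        moreover have "?R \<subseteq> \<Union>\<B>" using B(3) by blast
        ultimately show thesis using that B(2) by blast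
      qed
      have "\<pi> ` P \<subseteq> topspace T" using \<pi>(1) by (simp add: continuous_map_def image_subset_iff Pi_iff)
      then have "\<pi> ` (P - W) \<subseteq> U" using W(2) by blast
      moreover have "emeasure \<nu> C \<le> emeasure \<nu> (\<pi> ` (P - W))" using W(1) CQ by (auto simp: Q_def)
      ultimately show ?thesis using emeasure_mono[of "\<pi> ` (P - W)" U \<nu>] open_sets[OF U(1)] by (meson order_trans)
    qed
    then have "emeasure \<nu> C \<le> (INF U\<in>{U. openin T U \<and> \<pi> ` (P - \<Union>\<C>) \<subseteq> U}. emeasure \<nu> U)"
      by (intro INF_greatest) auto
    also have "\<dots> = emeasure \<nu> (\<pi> ` (P - \<Union>\<C>))"
      using regular_borel_probabilityD(5)[OF \<nu> image_sets[OF cpt]] by (simp add: Diff_subset)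
    finally have "emeasure \<nu> C \<le> emeasure \<nu> (\<pi> ` (P - \<Union>\<C>))" .
    moreover have "\<pi> ` (P - \<Union>\<C>) \<subseteq> C" using ne CQ by (fastforce simp: Q_def)
    moreover have "\<Union>\<C> \<subseteq> P" using CQ by (auto simp: Q_def)
    ultimately show "\<Union>\<C> \<in> Q" using cpt by (simp add: Q_def)
  qed
  then obtain W where W: "W \<in> Q" "\<And>X. X \<in> Q \<Longrightarrow> W \<subseteq> X \<Longrightarrow> X = W" by blast
  define Z where "Z = P - W"
  have Z: "compact Z" "Z \<subseteq> P" "\<pi> ` Z \<subseteq> C" "emeasure \<nu> C \<le> emeasure \<nu> (\<pi> ` Z)"
    using W(1) by (auto simp: Q_def Z_def)
  have minimal: "emeasure \<nu> (\<pi> ` Y) < emeasure \<nu> C" if Y: "compact Y" "Y \<subset> Z" for Y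
  proof (rule ccontr)
    assume "\<not> ?thesis"
    moreover have PY: "P - (P - Y) = Y" using Y(2) Z(2) by blast
    ultimately have "P - Y \<in> Q" using Y Z by (auto simp: Q_def PY)
    moreover have "W \<subseteq> P - Y" using W(1) Y(2) by (auto simp: Q_def Z_def)
    ultimately have "P - Y = W" by (rule W(2))
    then show False using Y(2) Z(2) PY by (auto simp: Z_def)
  qed
  have "Z \<noteq> {}" using Z(4) C(3) by auto
  then have "h ` Z \<noteq> {}" by blast
  then obtain U where U: "openin (top_of_set (h ` Z)) U" "U \<noteq> {}" "\<And>x y. x \<in> U \<Longrightarrow> y \<in> U \<Longrightarrow> (w x, w y) \<in> V"
    using w V unfolding fragmented_map_def by meson
  \<comment> \<open>Points of \<open>\<pi> Z\<close> outside \<open>\<pi> Y\<close> lift to \<open>Z - Y\<close> only, where \<open>w \<circ> h\<close> has small oscillation.\<close>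
  define Y where "Y = {p\<in>Z. h p \<notin> U}"
  have "openin (top_of_set Z) (Z \<inter> h -` U)"
    using U(1) continuous_on_subset[OF h Z(2)] by (simp add: continuous_on_open)
  then have "closedin (top_of_set Z) (Z - (Z \<inter> h -` U))"
    using closedin_diff[OF closedin_topspace, of "top_of_set Z"] by simp
  moreover have "Z - (Z \<inter> h -` U) = Y" by (auto simp: Y_def)
  ultimately have Y1: "compact Y" using Z(1) closedin_compact by metis
  have "U \<subseteq> h ` Z" using openin_imp_subset[OF U(1)] .
  then have Y2: "Y \<subset> Z" using U(2) by (auto simp: Y_def)
  have lt: "emeasure \<nu> (\<pi> ` Y) < emeasure \<nu> (\<pi> ` Z)"
    using minimal[OF Y1 Y2] Z(4) by simp
  have sZ: "\<pi> ` Z \<in> sets \<nu>" and sY: "\<pi> ` Y \<in> sets \<nu>"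
    using image_sets Z Y1 Y2 by auto
  let ?D = "\<pi> ` Z - \<pi> ` Y"
  have "emeasure \<nu> ?D \<noteq> 0"
  proof
    assume 0: "emeasure \<nu> ?D = 0"
    have "emeasure \<nu> (\<pi> ` Z) \<le> emeasure \<nu> (?D \<union> \<pi> ` Y)" using sZ sY by (intro emeasure_mono) auto
    also have "\<dots> \<le> emeasure \<nu> ?D + emeasure \<nu> (\<pi> ` Y)" using sZ sY by (intro emeasure_subadditive) auto
    finally show False using lt 0 by simp
  qed
  moreover have "\<exists>p\<in>P. \<exists>q\<in>P. \<pi> p = d \<and> \<pi> q = d' \<and> (w (h p), w (h q)) \<in> V" if d: "d \<in> ?D" "d' \<in> ?D" for d d'
  proof -
    obtain p q where "p \<in> Z" "\<pi> p = d" "q \<in> Z" "\<pi> q = d'" "p \<notin> Y" "q \<notin> Y" using d by blast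
    then show ?thesis using U(3) Z(2) unfolding Y_def by blast
  qed
  moreover have "?D \<subseteq> A" using Z(3) C(2) by blast
  moreover have "?D \<in> sets \<nu>" using sZ sY by auto
  ultimately show ?thesis
    by (intro bexI[of _ ?D]) (auto simp: zero_less_iff_neq_zero)
qed

section \<open>The enveloping semigroup and its minimal left ideals\<close>

lemma compact_enveloping_semigroup:
  assumes "flow G act"
  shows "compact (enveloping_semigroup G act)"
proof -
  have "compact (UNIV \<inter> enveloping_semigroup G act)"
    using assms unfolding enveloping_semigroup_def flow_def
    by (intro compact_Int_closed compact_UNIV_fun) auto
  then show ?thesis by simp
qed

lemma flow_continuous:
  assumes "flow G act" "g \<in> carrier G"
  shows "continuous_on UNIV (act g)"
  using assms homeomorphic_imp_continuous_map by (fastforce simp: flow_def)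

lemma enveloping_semigroup_comp:
  assumes fl: "flow G act" and p: "p \<in> enveloping_semigroup G act" and q: "q \<in> enveloping_semigroup G act"
  shows "p \<circ> q \<in> enveloping_semigroup G act"
proof -
  let ?E = "enveloping_semigroup G act"
  have clE: "closed ?E" by (simp add: enveloping_semigroup_def)
  interpret group_action G UNIV act using fl by (simp add: flow_def)
  have gE: "act g \<circ> q \<in> ?E" if g: "g \<in> carrier G" for g
  proof -
    have "(\<lambda>p. act g \<circ> p) ` closure (act ` carrier G) \<subseteq> ?E"
    proof (rule image_closure_subset)
      show "continuous_on (closure (act ` carrier G)) (\<lambda>p. act g \<circ> p)"
        using continuous_comp_left[OF flow_continuous[OF fl g]] continuous_on_subset by blast
      have "act g \<circ> act h \<in> act ` carrier G" if h: "h \<in> carrier G" for h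
      proof -
        have "act (g \<otimes>\<^bsub>G\<^esub> h) = act g \<circ> act h"
          using composition_rule[OF _ g h] by (simp add: fun_eq_iff)
        moreover have "g \<otimes>\<^bsub>G\<^esub> h \<in> carrier G"
          using g h fl by (simp add: flow_def group.is_monoid monoid.m_closed)
        ultimately show ?thesis by (metis imageI)
      qed
      then show "(\<lambda>p. act g \<circ> p) ` (act ` carrier G) \<subseteq> ?E"
        unfolding enveloping_semigroup_def using closure_subset by blast
    qed (rule clE)
    then show ?thesis using q unfolding enveloping_semigroup_def by blast
  qed
  have "(\<lambda>p. p \<circ> q) ` closure (act ` carrier G) \<subseteq> ?E"
    using continuous_on_subset[OF continuous_comp_right[of q] subset_UNIV] clE gE
    by (intro image_closure_subset) auto
  then show ?thesis using p unfolding enveloping_semigroup_def by blast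
qed

text \<open>
  For \<open>m \<in> M\<close> the left ideal \<open>E m\<close> is contained in \<open>M\<close>, so it equals \<open>M\<close>. It is compact because right
  multiplication by \<open>m\<close> is continuous.
\<close>

lemma closed_minimal_left_ideal:
  assumes fl: "flow G act" and M: "minimal_left_ideal (enveloping_semigroup G act) M"
  shows "closed M"
proof -
  let ?E = "enveloping_semigroup G act"
  obtain m where m: "m \<in> M" using M by (auto simp: minimal_left_ideal_def left_ideal_def)
  have ME: "M \<subseteq> ?E" "\<And>p q. p \<in> ?E \<Longrightarrow> q \<in> M \<Longrightarrow> p \<circ> q \<in> M"
    using M by (auto simp: minimal_left_ideal_def left_ideal_def)
  let ?J = "(\<lambda>p. p \<circ> m) ` ?E"
  have "left_ideal ?E ?J"
    unfolding left_ideal_def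
  proof (intro conjI ballI)
    show "?J \<noteq> {}" using m ME(1) by blast
    show "?J \<subseteq> ?E" using ME m by blast
    fix p q assume pq: "p \<in> ?E" "q \<in> ?J"
    then obtain r where r: "r \<in> ?E" "q = r \<circ> m" by blast
    have "p \<circ> q = (p \<circ> r) \<circ> m" by (simp add: r comp_assoc)
    then show "p \<circ> q \<in> ?J" using enveloping_semigroup_comp[OF fl pq(1) r(1)] by blast
  qed
  moreover have "?J \<subseteq> M" using ME(2) m by blast
  ultimately have "?J = M" using M by (simp add: minimal_left_ideal_def)
  moreover have "compact ?J"
    using continuous_on_subset[OF continuous_comp_right[of m] subset_UNIV] compact_enveloping_semigroup[OF fl]
    by (intro compact_continuous_image)
  ultimately show ?thesis using compact_imp_closed by metis
qed

section \<open>The Ellis group as a quotient of its pointwise closure\<close>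

locale Ellis_group_of_flow =
  fixes G :: "('g, 'm) monoid_scheme"
    and act :: "'g \<Rightarrow> 'x \<Rightarrow> 'x::{uniform_space, t2_space}"
    and M :: "('x \<Rightarrow> 'x) set" and u :: "'x \<Rightarrow> 'x"
  assumes fl: "flow G act"
    and minimal: "minimal_left_ideal (enveloping_semigroup G act) M"
    and u_M: "u \<in> M" and u_idem: "u \<circ> u = u"
begin

abbreviation "E \<equiv> enveloping_semigroup G act"
abbreviation "K \<equiv> carrier (ellis_group M u)"
abbreviation "\<tau> \<equiv> tau_topology G act M u"

lemma M_subset: "M \<subseteq> E" and M_left: "p \<in> E \<Longrightarrow> q \<in> M \<Longrightarrow> p \<circ> q \<in> M"
  using minimal by (auto simp: minimal_left_ideal_def left_ideal_def)

lemma u_E: "u \<in> E"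
  using M_subset u_M by blast

lemma K_subset_M: "K \<subseteq> M"
  using M_left u_E by (auto simp: ellis_group_def)

lemma u_comp_K: "k \<in> K \<Longrightarrow> u \<circ> k = k"
  using u_idem by (auto simp: ellis_group_def comp_assoc[symmetric])

lemma closure_K_subset_M: "closure K \<subseteq> M"
  using closure_minimal[OF K_subset_M closed_minimal_left_ideal[OF fl minimal]] .

lemma u_comp_closure_K: "p \<in> closure K \<Longrightarrow> u \<circ> p \<in> K"
  using closure_K_subset_M by (auto simp: ellis_group_def)

lemma compact_closure_K: "compact (closure K)"
proof -
  have "compact (E \<inter> closure K)"
    by (intro compact_Int_closed compact_enveloping_semigroup[OF fl]) simp
  moreover have "E \<inter> closure K = closure K" using closure_K_subset_M M_subset by blast
  ultimately show ?thesis by simp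
qed

lemma closure_of_\<tau>: "A \<subseteq> K \<Longrightarrow> \<tau> closure_of A = K \<inter> circ_op G act u A"
  using closure_of_tau_topology[OF fl u_E u_idem M_subset] M_left[OF u_E]
  by (simp add: tau_closure_def)

text \<open>
  If \<open>g \<in> G\<close> is close to \<open>u\<close>, then \<open>g p\<close> is close to \<open>u p\<close>; as \<open>g\<close> acts continuously, \<open>g a\<close> is still close
  to \<open>u p\<close> for all \<open>a \<in> A\<close> close enough to \<open>p\<close>.
\<close>

lemma u_comp_closure_in_tau_closure:
  assumes A: "A \<subseteq> K" and p: "p \<in> closure A"
  shows "u \<circ> p \<in> \<tau> closure_of A"
proof -
  have up: "u \<circ> p \<in> K" using closure_mono[OF A] p u_comp_closure_K by blast
  have "u \<circ> p \<in> circ_op G act u A"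
    unfolding circ_op_iff
  proof (intro conjI allI impI)
    show "u \<circ> p \<in> E" using up K_subset_M M_subset by blast
    fix N W assume NW: "open N \<and> u \<in> N \<and> open W \<and> u \<circ> p \<in> W"
    let ?N = "N \<inter> (\<lambda>q. q \<circ> p) -` W"
    have "open ?N" using NW continuous_comp_right open_vimage by blast
    moreover have "u \<in> ?N" using NW by simp
    ultimately obtain g where g: "g \<in> carrier G" "act g \<in> N" "act g \<circ> p \<in> W"
      using u_E unfolding enveloping_semigroup_def closure_iff_nhds_not_empty by blast
    have "open ((\<lambda>q. act g \<circ> q) -` W)"
      using NW continuous_comp_left[OF flow_continuous[OF fl g(1)]] open_vimage by blast
    moreover have "p \<in> (\<lambda>q. act g \<circ> q) -` W" using g by simp
    ultimately obtain a where "a \<in> A" "act g \<circ> a \<in> W"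
      using p unfolding closure_iff_nhds_not_empty by blast
    then show "\<exists>g\<in>carrier G. \<exists>a\<in>A. act g \<in> N \<and> act g \<circ> a \<in> W" using g by blast
  qed
  then show ?thesis using up by (simp add: closure_of_\<tau>[OF A])
qed

text \<open>
  Suppose \<open>p\<close> is a limit of points \<open>r\<close> of \<open>closure K\<close> with \<open>u r \<in> C\<close>, for a \<open>\<tau>\<close>-closed \<open>C\<close> not
  containing \<open>u p\<close>. Separate \<open>u p\<close> from \<open>C\<close> by disjoint \<open>\<tau>\<close>-open sets, \<open>U2\<close> being the one
  around \<open>C\<close>. Near such an \<open>r\<close> there are elements of \<open>U2\<close>, since \<open>u r\<close> lies in the \<open>\<tau>\<close>-closure of every pointwise neighbourhood of \<open>r\<close> in \<open>K\<close>.
  Hence \<open>p\<close> is a pointwise limit of elements of \<open>U2\<close>, and \<open>u p\<close> lies in the \<open>\<tau>\<close>-closure of \<open>U2\<close>, a contradiction.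
\<close>

lemma continuous_map_u_comp:
  assumes "compact_space \<tau>" "Hausdorff_space \<tau>"
  shows "continuous_map (top_of_set (closure K)) \<tau> (\<lambda>p. u \<circ> p)"
  unfolding continuous_map_closedin
proof (intro conjI ballI allI impI)
  show "(\<lambda>p. u \<circ> p) \<in> topspace (top_of_set (closure K)) \<rightarrow> topspace \<tau>"
    using u_comp_closure_K by (simp add: topspace_tau_topology)
  fix C assume C: "closedin \<tau> C"
  let ?R = "{p \<in> topspace (top_of_set (closure K)). u \<circ> p \<in> C}"
  have "closed ?R"
  proof (rule closure_subset_eq[THEN iffD1], rule subsetI, rule ccontr)
    fix p assume p: "p \<in> closure ?R" and n: "p \<notin> ?R"
    have "closure ?R \<subseteq> closure K" by (rule closure_minimal) auto
    then have pK: "p \<in> closure K" using p by blast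
    then have "u \<circ> p \<in> topspace \<tau> - C" using n u_comp_closure_K by (simp add: topspace_tau_topology)
    then obtain U1 U2 where U: "openin \<tau> U1" "openin \<tau> U2" "u \<circ> p \<in> U1" "C \<subseteq> U2" "disjnt U1 U2"
      using compact_Hausdorff_imp_regular_space[OF assms] C unfolding regular_space_def by meson
    have U2K: "U2 \<subseteq> K" using openin_subset[OF U(2)] by (simp add: topspace_tau_topology)
    have "p \<in> closure U2"
      unfolding closure_iff_nhds_not_empty
    proof (intro allI impI)
      fix S W assume SW: "S \<subseteq> W" "open S" "p \<in> S"
      obtain r where r: "r \<in> ?R" "r \<in> S"
        using p SW(2,3) unfolding closure_iff_nhds_not_empty by blast
      have "r \<in> closure (S \<inter> K)"
        using open_Int_closure_subset[OF SW(2), of K] r by auto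
      then have "u \<circ> r \<in> \<tau> closure_of (S \<inter> K)" by (intro u_comp_closure_in_tau_closure) auto
      moreover have "u \<circ> r \<in> U2" using r U(4) by blast
      ultimately obtain k where "k \<in> S \<inter> K" "k \<in> U2" using U(2) unfolding in_closure_of by blast
      then show "U2 \<inter> W \<noteq> {}" using SW(1) by blast
    qed
    then have "u \<circ> p \<in> \<tau> closure_of U2" by (rule u_comp_closure_in_tau_closure[OF U2K])
    then show False using U(1,3,5) unfolding in_closure_of disjnt_iff by blast
  qed
  then have "closedin (top_of_set (closure K)) (closure K \<inter> ?R)" by (rule closedin_closed_Int)
  moreover have "closure K \<inter> ?R = ?R" by auto
  ultimately show "closedin (top_of_set (closure K)) ?R" by simp
qed

text \<open>
  The value at \<open>k = u p\<close> is \<open>\<phi> (u (p x))\<close>: the continuous evaluation \<open>p \<mapsto> p x\<close> followed by the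
  fragmented map \<open>u\<close>.
\<close>

lemma coordinate_measurable:
  fixes \<phi> :: "'x \<Rightarrow> real"
  assumes tame: "tame_flow G act"
    and haar: "compact_space \<tau>" "Hausdorff_space \<tau>" "regular_borel_probability \<tau> \<nu>"
    and \<phi>: "continuous_on UNIV \<phi>"
  shows "(\<lambda>k. \<phi> (k x)) \<in> borel_measurable (completion \<nu>)"
proof (rule borel_measurable_completion_if_small_oscillation)
  interpret prob_space \<nu> by (rule regular_borel_probabilityD[OF haar(3)])
  show "finite_measure \<nu>" by (rule finite_measure_axioms)
  fix A and e :: real assume A: "A \<in> sets \<nu>" "0 < emeasure \<nu> A" and e: "0 < e"
  let ?V = "{z. \<bar>\<phi> (fst z) - \<phi> (snd z)\<bar> < e}"
  have "compact (UNIV :: 'x set)" using fl by (simp add: flow_def)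
  from uniformly_continuous_on_compact_space[OF this \<phi> e]
  have V: "eventually (\<lambda>z. z \<in> ?V) uniformity" by simp
  have surj: "topspace \<tau> \<subseteq> (\<lambda>p. u \<circ> p) ` closure K"
  proof
    fix k assume "k \<in> topspace \<tau>"
    then have "k \<in> K" by (simp add: topspace_tau_topology)
    then show "k \<in> (\<lambda>p. u \<circ> p) ` closure K"
      using u_comp_K closure_subset by (intro image_eqI[of _ _ k]) auto
  qed
  have frag: "fragmented_map u" using tame u_E by (simp add: tame_flow_def)
  have ev: "continuous_on (closure K) (\<lambda>p. p x)"
    using continuous_on_subset[OF continuous_on_product_coordinates subset_UNIV] .
  obtain D where D: "D \<in> sets \<nu>" "D \<subseteq> A" "0 < emeasure \<nu> D"
    "\<And>d d'. d \<in> D \<Longrightarrow> d' \<in> D \<Longrightarrow>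
      \<exists>p\<in>closure K. \<exists>q\<in>closure K. u \<circ> p = d \<and> u \<circ> q = d' \<and> (u (p x), u (q x)) \<in> ?V"
    using fragmented_quotient_small_oscillation[OF compact_closure_K continuous_map_u_comp[OF haar(1,2)]
        surj haar(2,3) ev frag V A] by blast
  have "\<bar>\<phi> (d x) - \<phi> (d' x)\<bar> < e" if d: "d \<in> D" "d' \<in> D" for d d'
    using D(4)[OF d] by auto
  then show "\<exists>D\<in>sets \<nu>. D \<subseteq> A \<and> 0 < emeasure \<nu> D \<and> (\<forall>k\<in>D. \<forall>k'\<in>D. \<bar>\<phi> (k x) - \<phi> (k' x)\<bar> < e)"
    using D by blast
qed

text \<open>
  The functions on \<open>E\<close> that are continuous and measurable on \<open>K\<close> form an algebra. By
  \<open>coordinate_measurable\<close> and Urysohn's lemma in \<open>X\<close> it separates points, so it is uniformly dense.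
\<close>

lemma continuous_function_measurable:
  fixes F :: "('x \<Rightarrow> 'x) \<Rightarrow> real"
  assumes tame: "tame_flow G act"
    and haar: "compact_space \<tau>" "Hausdorff_space \<tau>" "regular_borel_probability \<tau> \<nu>"
    and F: "continuous_on E F"
  shows "F \<in> borel_measurable (completion \<nu>)"
proof -
  define R where "R = {F :: ('x \<Rightarrow> 'x) \<Rightarrow> real. continuous_on E F \<and> F \<in> borel_measurable (completion \<nu>)}"
  have normal: "normal_space (euclidean :: 'x topology)"
    using fl Hausdorff_space_euclidean_t2 compact_Hausdorff_or_regular_imp_normal_space
    by (metis compact_space_def compactin_euclidean_iff flow_def topspace_euclidean)
  interpret R: function_ring_on R E
  proof
    show "compact E" by (rule compact_enveloping_semigroup[OF fl])
    fix p q :: "'x \<Rightarrow> 'x" assume "p \<noteq> q"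
    then obtain x where x: "p x \<noteq> q x" by blast
    have "closedin euclidean {p x}" "closedin euclidean {q x}" "disjnt {p x} {q x}" using x by auto
    then obtain \<phi> :: "'x \<Rightarrow> real"
      where \<phi>: "continuous_map euclidean euclideanreal \<phi>" "\<phi> ` {p x} \<subseteq> {0}" "\<phi> ` {q x} \<subseteq> {1}"
      using Urysohn_lemma_alt[OF normal] by metis
    have "continuous_on UNIV \<phi>" using \<phi>(1) by simp
    then have "continuous_on E (\<lambda>k. \<phi> (k x))"
      by (rule continuous_on_compose2[OF _ continuous_on_subset[OF continuous_on_product_coordinates subset_UNIV]]) simp
    moreover have "(\<lambda>k. \<phi> (k x)) \<in> borel_measurable (completion \<nu>)"
      using coordinate_measurable[OF tame haar \<open>continuous_on UNIV \<phi>\<close>] .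
    ultimately have "(\<lambda>k. \<phi> (k x)) \<in> R" by (simp add: R_def)
    moreover have "\<phi> (p x) \<noteq> \<phi> (q x)" using \<phi>(2,3) by simp
    ultimately show "\<exists>f\<in>R. f p \<noteq> f q" by (intro bexI[of _ "\<lambda>k. \<phi> (k x)"])
  qed (simp_all add: R_def continuous_on_add continuous_on_mult borel_measurable_add borel_measurable_times)
  have "\<exists>g. g \<in> R \<and> (\<forall>p\<in>E. \<bar>F p - g p\<bar> < inverse (real (Suc n)))" for n
    using R.Stone_Weierstrass_basic[OF F, of "inverse (real (Suc n))"] by auto
  then obtain g where g: "\<And>n. g n \<in> R" "\<And>n p. p \<in> E \<Longrightarrow> \<bar>F p - g n p\<bar> < inverse (real (Suc n))"
    by metis
  show ?thesis
  proof (rule borel_measurable_LIMSEQ_real)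
    show "g n \<in> borel_measurable (completion \<nu>)" for n using g(1) by (simp add: R_def)
    fix p assume "p \<in> space (completion \<nu>)"
    then have "p \<in> E"
      using K_subset_M M_subset by (auto simp: regular_borel_probabilityD(1)[OF haar(3)] topspace_tau_topology)
    then have "\<bar>g n p - F p\<bar> \<le> inverse (real (Suc n))" for n
      using g(2)[of p n] by (simp add: abs_minus_commute)
    then have "(\<lambda>n. g n p - F p) \<longlonglongrightarrow> 0"
      by (intro Lim_null_comparison[OF _ LIMSEQ_inverse_real_of_nat]) simp
    then show "(\<lambda>n. g n p) \<longlonglongrightarrow> F p" by (simp add: LIM_zero_iff)
  qed
qed
end

section \<open>The measure induced by the Ellis group\<close>

theorem lemma3p7:
  fixes G :: "('g, 'm) monoid_scheme"
    and act :: "'g \<Rightarrow> 'x \<Rightarrow> 'x::{uniform_space, t2_space}"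
    and M :: "('x \<Rightarrow> 'x) set" and u :: "'x \<Rightarrow> 'x"
    and haar :: "('x \<Rightarrow> 'x) measure"
  assumes "tame_flow G act"
    and "minimal_left_ideal (enveloping_semigroup G act) M"
    and "u \<in> M" and "u \<circ> u = u"
    and "normalized_Haar_measure (ellis_group M u) (tau_topology G act M u) haar"
  shows "(\<forall>F :: ('x \<Rightarrow> 'x) \<Rightarrow> complex. continuous_on (enveloping_semigroup G act) F \<longrightarrow>
            integrable (completion haar) F) \<and>
         positive_unital_functional (enveloping_semigroup G act)
            (\<lambda>F. integral\<^sup>L (completion haar) F) \<and>
         (\<exists>!\<mu>. regular_borel_probability (top_of_set (enveloping_semigroup G act)) \<mu> \<and>
            (\<forall>F :: ('x \<Rightarrow> 'x) \<Rightarrow> complex. continuous_on (enveloping_semigroup G act) F \<longrightarrow>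
               integral\<^sup>L \<mu> F = integral\<^sup>L (completion haar) F))"
proof -
  interpret Ellis_group_of_flow G act M u
    using assms by unfold_locales (auto simp: tame_flow_def)
  have haar: "compact_space \<tau>" "Hausdorff_space \<tau>" "regular_borel_probability \<tau> haar"
    using assms(5) by (auto simp: normalized_Haar_measure_def compact_Hausdorff_topological_group_def)
  interpret haar: prob_space haar by (rule regular_borel_probabilityD[OF haar(3)])
  interpret c: prob_space "completion haar"
    by (rule prob_spaceI) (simp add: haar.emeasure_space_1)
  have space_E: "space (completion haar) \<subseteq> E"
    using K_subset_M M_subset by (auto simp: regular_borel_probabilityD(1)[OF haar(3)] topspace_tau_topology)
  note meas = continuous_function_measurable[OF assms(1) haar]
  let ?T = "top_of_set E"
  have T: "compact_space ?T" "Hausdorff_space ?T"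
    using compact_enveloping_semigroup[OF fl] Hausdorff_space_euclidean_t2
    by (auto simp: compact_space_subtopology intro: Hausdorff_space_subtopology)
  interpret B: Baire_measurable_map "completion haar" ?T "\<lambda>k. k"
    using T space_E by unfold_locales (auto intro: meas)
  have measc: "F \<in> borel_measurable (completion haar)" if F: "continuous_on E F" for F :: "_ \<Rightarrow> complex"
  proof -
    have "continuous_on E (\<lambda>p. Re (F p))" "continuous_on E (\<lambda>p. Im (F p))"
      using F by (auto intro: continuous_intros)
    from meas[OF this(1)] meas[OF this(2)] show ?thesis
      by (simp add: borel_measurable_complex_iff)
  qed
  have bound: "\<exists>B. \<forall>p\<in>E. norm (F p) \<le> B" if F: "continuous_on E F" for F :: "_ \<Rightarrow> complex"
  proof -
    have "bounded (F ` E)"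
      using compact_continuous_image[OF F compact_enveloping_semigroup[OF fl]] by (rule compact_imp_bounded)
    then show ?thesis by (auto simp: bounded_iff)
  qed
  have int: "integrable (completion haar) F" if F: "continuous_on E F" for F :: "_ \<Rightarrow> complex"
  proof -
    obtain B where "\<forall>p\<in>E. norm (F p) \<le> B" using bound[OF F] by blast
    then show ?thesis
      using space_E by (intro c.integrable_const_bound[OF _ measc[OF F], of B] AE_I2) auto
  qed
  have pos: "positive_unital_functional E (\<lambda>F. integral\<^sup>L (completion haar) F)"
    unfolding positive_unital_functional_def
  proof (intro conjI allI impI; (elim conjE)?)
    fix F F' :: "_ \<Rightarrow> complex" assume "\<forall>p\<in>E. F p = F' p"
    then show "integral\<^sup>L (completion haar) F = integral\<^sup>L (completion haar) F'"
      using space_E by (intro Bochner_Integration.integral_cong) auto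
  next
    fix F F' :: "_ \<Rightarrow> complex" assume "continuous_on E F" "continuous_on E F'"
    then show "integral\<^sup>L (completion haar) (\<lambda>p. F p + F' p) = integral\<^sup>L (completion haar) F + integral\<^sup>L (completion haar) F'"
      by (intro Bochner_Integration.integral_add int)
  next
    fix c and F :: "_ \<Rightarrow> complex" assume "continuous_on E F"
    then show "integral\<^sup>L (completion haar) (\<lambda>p. c * F p) = c * integral\<^sup>L (completion haar) F"
      by (simp add: int)
  next
    fix F :: "_ \<Rightarrow> complex" assume F: "continuous_on E F" "\<forall>p\<in>E. F p \<in> \<real> \<and> 0 \<le> Re (F p)"
    have "integral\<^sup>L (completion haar) F = integral\<^sup>L (completion haar) (\<lambda>p. complex_of_real (Re (F p)))"
      using F(2) space_E by (intro Bochner_Integration.integral_cong) auto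
    also have "\<dots> = complex_of_real (integral\<^sup>L (completion haar) (\<lambda>p. Re (F p)))" by simp
    finally have eq: "integral\<^sup>L (completion haar) F = complex_of_real (integral\<^sup>L (completion haar) (\<lambda>p. Re (F p)))" .
    show "integral\<^sup>L (completion haar) F \<in> \<real>" unfolding eq by simp
    have "0 \<le> integral\<^sup>L (completion haar) (\<lambda>p. Re (F p))"
      using F(2) space_E by (intro integral_nonneg_AE AE_I2) auto
    then show "0 \<le> Re (integral\<^sup>L (completion haar) F)" unfolding eq by simp
  next
    show "integral\<^sup>L (completion haar) (\<lambda>_. 1 :: complex) = 1" by (simp add: haar.prob_space)
  qed
  have ex: "integral\<^sup>L B.regular_image F = integral\<^sup>L (completion haar) F" if F: "continuous_on E F" for F :: "_ \<Rightarrow> complex"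
  proof -
    interpret \<mu>: prob_space B.regular_image by (rule B.prob_space_regular_image)
    have c: "continuous_map ?T euclideanreal (\<lambda>p. Re (F p))" "continuous_map ?T euclideanreal (\<lambda>p. Im (F p))"
      using F by (auto intro: continuous_intros)
    have "F \<in> borel_measurable B.regular_image"
      using B.borel_measurable_regular_image[OF c(1)] B.borel_measurable_regular_image[OF c(2)]
      by (simp add: borel_measurable_complex_iff)
    moreover obtain B where "\<forall>p\<in>E. norm (F p) \<le> B" using bound[OF F] by blast
    ultimately have i: "integrable B.regular_image F"
      by (intro \<mu>.integrable_const_bound[of _ B] AE_I2) (auto simp: B.space_regular_image)
    show ?thesis
      using B.integral_regular_image[OF c(1)] B.integral_regular_image[OF c(2)] i int[OF F]
      by (simp add: complex_eq_iff)
  qed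
  have uniq: "\<mu> = B.regular_image"
    if \<mu>: "regular_borel_probability ?T \<mu>"
      and eq: "\<forall>F :: _ \<Rightarrow> complex. continuous_on E F \<longrightarrow> integral\<^sup>L \<mu> F = integral\<^sup>L (completion haar) F" for \<mu>
  proof (rule regular_borel_probability_eqI[OF T \<mu> B.regular_borel_probability_regular_image])
    fix F assume "continuous_map ?T euclideanreal F"
    then have F: "continuous_on E (\<lambda>p. complex_of_real (F p))"
      by (auto intro: continuous_intros)
    have "complex_of_real (integral\<^sup>L \<mu> F) = complex_of_real (integral\<^sup>L B.regular_image F)"
      using eq F ex[OF F] by (metis integral_complex_of_real)
    then show "integral\<^sup>L \<mu> F = integral\<^sup>L B.regular_image F" by simp
  qed
  show ?thesis
    using int pos ex uniq B.regular_borel_probability_regular_image by blast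
qed

end
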